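(* Let $x_1,x_2,x_3,x_4\in\mathbb R^3$ be the vertices of a "wedge" tetrahedron, i.e. $r_{13}=r_{24}=a$, $r_{23}=r_{14}=b$, $r_{12}=x$, $r_{34}=y$. Then $$\begin{aligned}\Re(D_4)=\ &(d_3(a,b,x)+8abx)(d_3(a,b,y)+8aby)+d_3(a,b,x)\,d_3(a,b,y)\\&+2x((a+b)^2-y^2)\,d_3(a,b,y)+2y((a+b)^2-x^2)\,d_3(a,b,x)\\&+4(a^2+b^2-xy)(2a^2+2b^2-x^2-y^2)(a-b)^2\\&+2(xy-(a-b)^2)(x^2-(a-b)^2)(y^2-(a-b)^2)+288V^2.\end{aligned}$$ Moreover $$\Re(D_4)\ge (d_3(a,b,x)+8abx)(d_3(a,b,y)+8aby)+d_3(a,b,x)\,d_3(a,b,y)+288V^2$$ and $$\Re(D_4)\ge (d_3(a,b,x)+8abx)(d_3(a,b,y)+8aby)+3\,d_3(a,b,x)\,d_3(a,b,y).$$ In particular the Atiyah–Sutcliffe conjectures C2, $|D_4|\ge 64\prod_{1\le i<j\le4}r_{ij}$, and C3, $|D_4|^2\ge\prod_{\{i<j<k\}\subset\{1,2,3,4\}}\bigl(d_3(r_{ij},r_{ik},r_{jk})+8r_{ij}r_{ik}r_{jk}\bigr)$, hold for wedge tetrahedra.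
   Context: Put $d_3(a,b,c)=(a+b-c)(b+c-a)(c+a-b)$. For distinct points $x_1,\dots,x_4\in\mathbb R^3$ let $r_{ij}=|x_i-x_j|$, and let $V$ be the volume of the tetrahedron with these vertices ($V=0$ if coplanar). The (non-normalized) Atiyah determinant $D_4\in\mathbb C$ is defined as follows. Identify $S^2$ with $\mathbb{CP}^1=\mathbb C\cup\{\infty\}$ by stereographic projection, so that the antipode of $t$ is $-1/\bar t$. For $i\ne j$ let $t_{ij}$ be the point corresponding to the unit vector $(x_j-x_i)/r_{ij}$. For each pair $i<j$ choose a unit vector $(\alpha,\beta)\in\mathbb C^2$ such that $\ell_{ij}(t)=\alpha t+\beta$ has root $t_{ij}$ (with $\alpha=0$ if $t_{ij}=\infty$), and put $\ell_{ji}(t)=-\bar\beta t+\bar\alpha$ (which has root $t_{ji}$). Let $p_i(t)=\prod_{j\ne i}\ell_{ij}(t)=\sum_{j=1}^4 m_{ij}t^{j-1}$ and $D_4=64\prod_{1\le i<j\le4}r_{ij}\cdot\det(m_{ij})$; this does not depend on the choices. Known fact (Eastwood–Norbury): $$\Re(D_4)=64\prod_{i<j}r_{ij}-4d_3(r_{12}r_{34},r_{13}r_{24},r_{14}r_{23})+A_4+288V^2,$$ $$A_4=\sum_{l=1}^4\Bigl(\sum_{i\ne l}r_{li}\bigl((r_{lj}+r_{lk})^2-r_{jk}^2\bigr)\Bigr)d_3(r_{ij},r_{ik},r_{jk}),\qquad \{j,k\}=\{1,2,3,4\}\setminus\{l,i\}.$$ *)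

theory Defs
  imports "HOL-Analysis.Analysis" "HOL-Computational_Algebra.Polynomial"
    "Jordan_Normal_Form.Determinant"
begin

no_notation vec_index (infixl "$" 100)

definition d3 :: "real \<Rightarrow> real \<Rightarrow> real \<Rightarrow> real" where
  "d3 a b c = (a + b - c) * (b + c - a) * (c + a - b)"

text \<open>A configuration is a map on indices; only its values at \<open>1, 2, 3, 4\<close> matter.\<close>

definition edge :: "(nat \<Rightarrow> real^3) \<Rightarrow> nat \<Rightarrow> nat \<Rightarrow> real" where
  "edge X i j = dist (X i) (X j)"

definition tetra_volume :: "(nat \<Rightarrow> real^3) \<Rightarrow> real" where
  "tetra_volume X = measure lebesgue (convex hull (X ` {1..4}))"

definition pairs4 :: "(nat \<times> nat) set" where
  "pairs4 = {(i, j). 1 \<le> i \<and> i < j \<and> j \<le> 4}"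

definition triples4 :: "(nat \<times> nat \<times> nat) set" where
  "triples4 = {(i, j, k). 1 \<le> i \<and> i < j \<and> j < k \<and> k \<le> 4}"

text \<open>Stereographic projection from the north pole, with values in the Riemann sphere;
  \<^const>\<open>None\<close> is the point at infinity.  The antipode of \<open>t\<close> is \<open>-1 / cnj t\<close>
  (lemma \<open>stereo_antipode\<close>).\<close>

definition stereo :: "real^3 \<Rightarrow> complex option" where
  "stereo u = (if u $ 3 = 1 then None
     else Some (Complex (u $ 1) (u $ 2) / complex_of_real (1 - u $ 3)))"

definition direction_pt :: "(nat \<Rightarrow> real^3) \<Rightarrow> nat \<Rightarrow> nat \<Rightarrow> complex option" where
  "direction_pt X i j = stereo ((1 / edge X i j) *\<^sub>R (X j - X i))"

text \<open>The linear form \<open>\<alpha> t + \<beta>\<close>, with unit coefficient vector, has the given root.\<close>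

definition unit_form_root :: "complex \<Rightarrow> complex \<Rightarrow> complex option \<Rightarrow> bool" where
  "unit_form_root \<alpha> \<beta> z \<longleftrightarrow> (cmod \<alpha>)\<^sup>2 + (cmod \<beta>)\<^sup>2 = 1 \<and>
     (case z of None \<Rightarrow> \<alpha> = 0 | Some t \<Rightarrow> \<alpha> * t + \<beta> = 0)"

text \<open>The determinant below does not depend on the choice of the linear forms, so that the
  choice is kept as a parameter, constrained by the following predicate.\<close>

definition admissible_forms ::
    "(nat \<Rightarrow> real^3) \<Rightarrow> (nat \<Rightarrow> nat \<Rightarrow> complex) \<Rightarrow> (nat \<Rightarrow> nat \<Rightarrow> complex) \<Rightarrow> bool" where
  "admissible_forms X \<alpha> \<beta> \<longleftrightarrow>
     (\<forall>(i, j) \<in> pairs4. unit_form_root (\<alpha> i j) (\<beta> i j) (direction_pt X i j))"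

definition lin_form ::
    "(nat \<Rightarrow> nat \<Rightarrow> complex) \<Rightarrow> (nat \<Rightarrow> nat \<Rightarrow> complex) \<Rightarrow> nat \<Rightarrow> nat \<Rightarrow> complex poly" where
  "lin_form \<alpha> \<beta> i j =
     (if i < j then [:\<beta> i j, \<alpha> i j:] else [:cnj (\<alpha> j i), - cnj (\<beta> j i):])"

definition atiyah_poly ::
    "(nat \<Rightarrow> nat \<Rightarrow> complex) \<Rightarrow> (nat \<Rightarrow> nat \<Rightarrow> complex) \<Rightarrow> nat \<Rightarrow> complex poly" where
  "atiyah_poly \<alpha> \<beta> i = (\<Prod>j \<in> {1..4} - {i}. lin_form \<alpha> \<beta> i j)"

text \<open>Matrix indices start at \<open>0\<close>: row \<open>i\<close> belongs to point \<open>i + 1\<close>, column \<open>j\<close> to \<open>t ^ j\<close>.\<close>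

definition atiyah_D4 ::
    "(nat \<Rightarrow> real^3) \<Rightarrow> (nat \<Rightarrow> nat \<Rightarrow> complex) \<Rightarrow> (nat \<Rightarrow> nat \<Rightarrow> complex) \<Rightarrow> complex" where
  "atiyah_D4 X \<alpha> \<beta> =
     64 * complex_of_real (\<Prod>(i, j) \<in> pairs4. edge X i j) *
     Determinant.det (Matrix.mat 4 4 (\<lambda>(i, j). coeff (atiyah_poly \<alpha> \<beta> (i + 1)) j))"

lemma stereo_antipode:
  assumes "norm u = 1" "u $ 3 \<noteq> 1" "u $ 3 \<noteq> -1"
  shows "stereo (- u) = map_option (\<lambda>t. - 1 / cnj t) (stereo u)"
proof -
  have "(u $ 1)\<^sup>2 + (u $ 2)\<^sup>2 + (u $ 3)\<^sup>2 = 1"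
    using assms(1) by (simp add: norm_eq_1 inner_vec_def sum_3 power2_eq_square)
  then have *: "(u $ 1)\<^sup>2 + (u $ 2)\<^sup>2 = (1 - u $ 3) * (1 + u $ 3)"
    by (simp add: algebra_simps power2_eq_square)
  have n1: "1 - u $ 3 \<noteq> 0" and n2: "1 + u $ 3 \<noteq> 0" and n3: "- u $ 3 \<noteq> 1" using assms by auto
  let ?w = "Complex (u $ 1) (u $ 2)"
  have w: "?w * cnj ?w = complex_of_real ((1 - u $ 3) * (1 + u $ 3))"
    unfolding complex_mult_cnj using * by simp
  then have "cnj ?w \<noteq> 0" using n1 n2 by (metis mult_eq_0_iff of_real_eq_0_iff)
  then have "?w / complex_of_real (1 + u $ 3) = complex_of_real (1 - u $ 3) / cnj ?w"
    using w n2
    by (simp add: frac_eq_eq del: of_real_add of_real_diff complex_cnj add: of_real_mult)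
  moreover have "Complex (- u $ 1) (- u $ 2) = - ?w" by (simp add: complex_eq_iff)
  ultimately show ?thesis
    using assms n3 by (simp add: stereo_def del: of_real_add of_real_diff)
qed

lemma unit_form_root_exists: "\<exists>\<alpha> \<beta>. unit_form_root \<alpha> \<beta> z"
proof (cases z)
  case None
  then show ?thesis by (intro exI[of _ 0] exI[of _ 1]) (simp add: unit_form_root_def)
next
  case (Some t)
  define s where "s = sqrt (1 + (cmod t)\<^sup>2)"
  have p: "1 + (cmod t)\<^sup>2 > 0" by (simp add: add_pos_nonneg)
  have s2: "s\<^sup>2 = 1 + (cmod t)\<^sup>2" and "s > 0" using p by (simp_all add: s_def)
  have "(cmod (1 / complex_of_real s))\<^sup>2 + (cmod (- t / complex_of_real s))\<^sup>2
      = (1 + (cmod t)\<^sup>2) / s\<^sup>2"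
    using \<open>s > 0\<close> by (simp add: norm_divide power_divide add_divide_distrib)
  also have "\<dots> = 1" using s2 p by simp
  finally show ?thesis unfolding unit_form_root_def Some
    by (intro exI[of _ "1 / complex_of_real s"] exI[of _ "- t / complex_of_real s"]) simp
qed

lemma admissible_forms_exist: "\<exists>\<alpha> \<beta>. admissible_forms X \<alpha> \<beta>"
proof -
  have "\<forall>i j. \<exists>p. unit_form_root (fst p) (snd p) (direction_pt X i j)"
    using unit_form_root_exists by simp
  then obtain p where
    "\<forall>i j. unit_form_root (fst (p i j)) (snd (p i j)) (direction_pt X i j)" by metis
  then show ?thesis
    by (intro exI[of _ "\<lambda>i j. fst (p i j)"] exI[of _ "\<lambda>i j. snd (p i j)"])
      (auto simp: admissible_forms_def)
qed

end

(* A wedge tetrahedron is invariant under the half-turn about the line through the midpoints of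
   the edges 12 and 34.  The determinant is invariant under SU(2), acting on linear forms, so this
   line may be taken as the polar axis.  The determinant is bilinear in each pair of forms
   (l_ij, l_ji), and up to the factor 2 r_ij the products of their coefficients are the entries of
   the Hermitian matrix [[r - h, -z], [-cnj z, r + h]], where h is the height and z the complex
   planar coordinate of x_j - x_i with respect to the axis.  So D_4 is a polynomial in the edge lengths,
   the common height g of the edges 13, 14, 23, 24 and the planar coordinates Z, W of the edges 12
   and 34.  Everything in its real part is determined by |Z| = x, |W| = y,
   Re (Z cnj W) = b^2 - a^2 and 4 g^2 = 2 a^2 + 2 b^2 - x^2 - y^2.  The volume comes from the Gram
   determinant.

   With m = a + b, d = (a - b)^2, p = x^2 - d, q = y^2 - d and N = 4 g^2, the excess in the last
   lower bound is twice
     x (m + y) (m - y)^2 q + y (m + x) (m - x)^2 p + N (x y - d)^2 + (x y - d) p q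
       - (m - x) (m - y) p q,
   and the first two terms dominate the last one because x (m + y) >= p and y (m + x) >= q. *)

theory Submission
  imports Defs
begin

no_notation scalar_prod (infix "\<bullet>" 70)

section \<open>The determinant as a polynomial in products of coefficients\<close>

text \<open>Deleting a row and a column only shifts the index function, so each minor is again a
  \<open>Matrix.mat\<close> and the expansion can be iterated by rewriting.\<close>

lemma det_mat_Suc:
  fixes f :: "nat \<times> nat \<Rightarrow> 'a::comm_ring_1"
  shows "Determinant.det (Matrix.mat (Suc n) (Suc n) f) =
    (\<Sum>j<Suc n. (-1) ^ j * f (0, j) *
      Determinant.det (Matrix.mat n n (\<lambda>(i, k). f (Suc i, if k < j then k else Suc k))))"
proof -
  let ?A = "Matrix.mat (Suc n) (Suc n) f"
  have "Determinant.det ?A = (\<Sum>j<Suc n. ?A $$ (0, j) * cofactor ?A 0 j)"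
    by (rule laplace_expansion_row[of _ "Suc n"]) auto
  also have "\<dots> = (\<Sum>j<Suc n. (-1) ^ j * f (0, j) *
      Determinant.det (Matrix.mat n n (\<lambda>(i, k). f (Suc i, if k < j then k else Suc k))))"
  proof (rule sum.cong[OF refl])
    fix j assume j: "j \<in> {..<Suc n}"
    have "mat_delete ?A 0 j = Matrix.mat n n (\<lambda>(i, k). f (Suc i, if k < j then k else Suc k))"
      by (rule eq_matI) (auto simp: mat_delete_def)
    then show "?A $$ (0, j) * cofactor ?A 0 j = (-1) ^ j * f (0, j) *
      Determinant.det (Matrix.mat n n (\<lambda>(i, k). f (Suc i, if k < j then k else Suc k)))"
      using j by (simp add: cofactor_def)
  qed
  finally show ?thesis .
qed

text \<open>Laplace expansion along the first two rows: each of their 2x2 minors is paired with the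
  complementary minor of the last two rows.\<close>

lemma det_mat_4:
  fixes f :: "nat \<times> nat \<Rightarrow> 'a::comm_ring_1"
  shows "Determinant.det (Matrix.mat 4 4 f) =
    (f (0,0) * f (1,1) - f (0,1) * f (1,0)) * (f (2,2) * f (3,3) - f (2,3) * f (3,2))
  - (f (0,0) * f (1,2) - f (0,2) * f (1,0)) * (f (2,1) * f (3,3) - f (2,3) * f (3,1))
  + (f (0,0) * f (1,3) - f (0,3) * f (1,0)) * (f (2,1) * f (3,2) - f (2,2) * f (3,1))
  + (f (0,1) * f (1,2) - f (0,2) * f (1,1)) * (f (2,0) * f (3,3) - f (2,3) * f (3,0))
  - (f (0,1) * f (1,3) - f (0,3) * f (1,1)) * (f (2,0) * f (3,2) - f (2,2) * f (3,0))
  + (f (0,2) * f (1,3) - f (0,3) * f (1,2)) * (f (2,0) * f (3,1) - f (2,1) * f (3,0))"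
proof -
  have "Determinant.det (Matrix.mat (Suc (Suc (Suc (Suc 0)))) (Suc (Suc (Suc (Suc 0)))) f) =
    (f (0,0) * f (1,1) - f (0,1) * f (1,0)) * (f (2,2) * f (3,3) - f (2,3) * f (3,2))
  - (f (0,0) * f (1,2) - f (0,2) * f (1,0)) * (f (2,1) * f (3,3) - f (2,3) * f (3,1))
  + (f (0,0) * f (1,3) - f (0,3) * f (1,0)) * (f (2,1) * f (3,2) - f (2,2) * f (3,1))
  + (f (0,1) * f (1,2) - f (0,2) * f (1,1)) * (f (2,0) * f (3,3) - f (2,3) * f (3,0))
  - (f (0,1) * f (1,3) - f (0,3) * f (1,1)) * (f (2,0) * f (3,2) - f (2,2) * f (3,0))
  + (f (0,2) * f (1,3) - f (0,3) * f (1,2)) * (f (2,0) * f (3,1) - f (2,1) * f (3,0))"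
    by (simp add: det_mat_Suc numeral_2_eq_2 numeral_3_eq_3 algebra_simps)
  then show ?thesis by (simp add: eval_nat_numeral)
qed

lemma coeff_linear_product3:
  fixes a1 a2 a3 b1 b2 b3 :: "'a::comm_ring_1"
  defines "p \<equiv> [:b1, a1:] * ([:b2, a2:] * [:b3, a3:])"
  shows "coeff p 0 = b1 * b2 * b3"
    and "coeff p (Suc 0) = a1 * b2 * b3 + b1 * a2 * b3 + b1 * b2 * a3"
    and "coeff p 2 = a1 * a2 * b3 + a1 * b2 * a3 + b1 * a2 * a3"
    and "coeff p 3 = a1 * a2 * a3"
  by (simp_all add: p_def numeral_2_eq_2 numeral_3_eq_3 algebra_simps)

lemma atiyah_poly_products:
  "atiyah_poly \<alpha> \<beta> 1 = lin_form \<alpha> \<beta> 1 2 * (lin_form \<alpha> \<beta> 1 3 * lin_form \<alpha> \<beta> 1 4)"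
  "atiyah_poly \<alpha> \<beta> 2 = lin_form \<alpha> \<beta> 2 1 * (lin_form \<alpha> \<beta> 2 3 * lin_form \<alpha> \<beta> 2 4)"
  "atiyah_poly \<alpha> \<beta> 3 = lin_form \<alpha> \<beta> 3 1 * (lin_form \<alpha> \<beta> 3 2 * lin_form \<alpha> \<beta> 3 4)"
  "atiyah_poly \<alpha> \<beta> 4 = lin_form \<alpha> \<beta> 4 1 * (lin_form \<alpha> \<beta> 4 2 * lin_form \<alpha> \<beta> 4 3)"
proof -
  have "{1..4} = {1, 2, 3, 4::nat}" by auto
  then have "{1..4} - {1} = {2, 3, 4::nat}" "{1..4} - {2} = {1, 3, 4::nat}"
    "{1..4} - {3} = {1, 2, 4::nat}" "{1..4} - {4} = {1, 2, 3::nat}"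
    by auto
  then show
    "atiyah_poly \<alpha> \<beta> 1 = lin_form \<alpha> \<beta> 1 2 * (lin_form \<alpha> \<beta> 1 3 * lin_form \<alpha> \<beta> 1 4)"
    "atiyah_poly \<alpha> \<beta> 2 = lin_form \<alpha> \<beta> 2 1 * (lin_form \<alpha> \<beta> 2 3 * lin_form \<alpha> \<beta> 2 4)"
    "atiyah_poly \<alpha> \<beta> 3 = lin_form \<alpha> \<beta> 3 1 * (lin_form \<alpha> \<beta> 3 2 * lin_form \<alpha> \<beta> 3 4)"
    "atiyah_poly \<alpha> \<beta> 4 = lin_form \<alpha> \<beta> 4 1 * (lin_form \<alpha> \<beta> 4 2 * lin_form \<alpha> \<beta> 4 3)"
    by (simp_all add: atiyah_poly_def)
qed

section \<open>Third symmetric powers and the multilinear expansion\<close>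

definition atiyah_matrix ::
    "(nat \<Rightarrow> nat \<Rightarrow> complex) \<Rightarrow> (nat \<Rightarrow> nat \<Rightarrow> complex) \<Rightarrow> complex mat" where
  "atiyah_matrix \<alpha> \<beta> = Matrix.mat 4 4 (\<lambda>(i, j). coeff (atiyah_poly \<alpha> \<beta> (i + 1)) j)"

text \<open>Row \<open>k\<close> holds the coefficients of \<open>(a t + b) ^ k * (c t + d) ^ (3 - k)\<close>, so that the matrix
  is the third symmetric power of \<open>t \<mapsto> (a t + b) / (c t + d)\<close>.\<close>

definition sym3 :: "'a::comm_ring_1 \<Rightarrow> 'a \<Rightarrow> 'a \<Rightarrow> 'a \<Rightarrow> 'a mat" where
  "sym3 a b c d = Matrix.mat 4 4 (\<lambda>(k, j).
     [[d ^ 3, 3 * c * d\<^sup>2, 3 * c\<^sup>2 * d, c ^ 3],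
      [b * d\<^sup>2, a * d\<^sup>2 + 2 * b * c * d, 2 * a * c * d + b * c\<^sup>2, a * c\<^sup>2],
      [b\<^sup>2 * d, 2 * a * b * d + b\<^sup>2 * c, a\<^sup>2 * d + 2 * a * b * c, a\<^sup>2 * c],
      [b ^ 3, 3 * a * b\<^sup>2, 3 * a\<^sup>2 * b, a ^ 3]] ! k ! j)"

text \<open>If a 2x2 matrix has eigenvalues \<open>u\<close>, \<open>v\<close>, its symmetric cube
  has eigenvalues \<open>u^3\<close>, \<open>u^2 v\<close>, \<open>u v^2\<close>,
  \<open>v^3\<close>, whose product is \<open>(u v)^6\<close>.\<close>

lemma det_sym3:
  fixes a b c d :: "'a::idom"
  shows "Determinant.det (sym3 a b c d) = (a * d - b * c) ^ 6"
  unfolding sym3_def det_mat_4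
  by simp Groebner_Basis.algebra

text \<open>Expand the product of the forms \<open>a_i T + b_i S\<close> in the monomials
  \<open>T^k S^(3-k)\<close>, then put \<open>T = a t + b\<close> and \<open>S = c t + d\<close>:
  the monomials turn into the rows of \<open>sym3\<close>.\<close>

lemma coeff_linear_product3_sym3:
  fixes a b c d a1 a2 a3 b1 b2 b3 :: "'a::comm_ring_1"
  assumes "j < 4"
  shows "coeff ([:b1 * d + a1 * b, a1 * a + b1 * c:] *
      ([:b2 * d + a2 * b, a2 * a + b2 * c:] * [:b3 * d + a3 * b, a3 * a + b3 * c:])) j =
    (\<Sum>k<4. coeff ([:b1, a1:] * ([:b2, a2:] * [:b3, a3:])) k * sym3 a b c d $$ (k, j))"
proof -
  have sum4: "(\<Sum>k<4. f k) = f 0 + f (Suc 0) + f 2 + f 3" for f :: "nat \<Rightarrow> 'a"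
    by (simp add: eval_nat_numeral)
  consider "j = 0" | "j = Suc 0" | "j = 2" | "j = 3" using assms by linarith
  then show ?thesis
    unfolding sum4 coeff_linear_product3
    by cases (hypsubst, unfold coeff_linear_product3,
        simp add: sym3_def algebra_simps power2_eq_square power3_eq_cube)+
qed

text \<open>The determinant is linear in each pair \<open>(lin_form i j, lin_form j i)\<close>, hence a polynomial in
  the products of their coefficients: \<open>P = \<alpha> * cnj \<alpha>\<close>, \<open>Q = \<beta> * cnj \<beta>\<close>, \<open>R = \<alpha> * cnj \<beta>\<close>,
  \<open>S = \<beta> * cnj \<alpha>\<close>.\<close>

definition atiyah_expansion ::
    "(nat \<Rightarrow> nat \<Rightarrow> 'a) \<Rightarrow> (nat \<Rightarrow> nat \<Rightarrow> 'a) \<Rightarrow> (nat \<Rightarrow> nat \<Rightarrow> 'a) \<Rightarrow> (nat \<Rightarrow> nat \<Rightarrow> 'a) \<Rightarrow> 'a::comm_ring_1"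
  where "atiyah_expansion P Q R S =
     S 1 2 * (R 3 4 * (S 1 3 * (R 2 4 * (Q 1 4 * (Q 2 3 + P 2 3)) + Q 2 4 * (Q 1 4 * R 2 3
     - R 1 4 * Q 2 3)) + Q 1 3 * (R 2 4 * (Q 1 4 * S 2 3 - S 1 4 * Q 2 3) + P 2 4 *
     (- Q 1 4 * Q 2 3 - S 1 4 * R 2 3) + Q 2 4 * (Q 1 4 * P 2 3 + P 1 4 * Q 2 3 - S 1 4 *
     R 2 3 - R 1 4 * S 2 3) + S 2 4 * (R 1 4 * Q 2 3 - Q 1 4 * R 2 3)) + P 1 3 * (Q 2 4 *
     (- Q 1 4 * Q 2 3 - R 1 4 * S 2 3)) + R 1 3 * (Q 2 4 * (S 1 4 * Q 2 3 - Q 1 4 * S 2 3)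
     + S 2 4 * (Q 1 4 * Q 2 3 + P 1 4 * Q 2 3))) + Q 3 4 * (Q 1 3 * (R 2 4 * (Q 1 4 *
     (- Q 2 3 - P 2 3)) + Q 2 4 * (R 1 4 * Q 2 3 - Q 1 4 * R 2 3)) + S 1 3 * (R 2 4 *
     (- Q 1 4 * R 2 3 - R 1 4 * P 2 3)) + R 1 3 * (Q 2 4 * (Q 1 4 * Q 2 3 + R 1 4 *
     S 2 3)) + P 1 3 * (R 2 4 * (R 1 4 * S 2 3 - Q 1 4 * P 2 3) + Q 2 4 * (R 1 4 * (Q 2 3
     + P 2 3)))) + P 3 4 * (Q 1 3 * (R 2 4 * (- Q 1 4 * Q 2 3 - S 1 4 * R 2 3) + Q 2 4 *
     (R 1 4 * Q 2 3 - Q 1 4 * R 2 3) + P 2 4 * (- Q 1 4 * R 2 3 - P 1 4 * R 2 3))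
     + R 1 3 * (Q 2 4 * (Q 1 4 * Q 2 3 + P 1 4 * Q 2 3) + P 2 4 * (P 1 4 * Q 2 3 - S 1 4 *
     R 2 3) + S 2 4 * (R 1 4 * Q 2 3 + P 1 4 * R 2 3)))) + Q 1 2 * (R 3 4 * (S 1 3 *
     (Q 2 4 * (Q 1 4 * (- Q 2 3 - P 2 3)) + R 2 4 * (- Q 1 4 * S 2 3 - S 1 4 * P 2 3)
     + P 2 4 * (S 1 4 * R 2 3 - Q 1 4 * P 2 3)) + Q 1 3 * (Q 2 4 * (S 1 4 * Q 2 3
     - Q 1 4 * S 2 3) + S 2 4 * (Q 1 4 * Q 2 3 + S 1 4 * R 2 3) + P 2 4 * (S 1 4 * (Q 2 3
     + P 2 3)))) + Q 3 4 * (Q 1 3 * (Q 2 4 * (Q 1 4 * (Q 2 3 + P 2 3)) + R 2 4 * (Q 1 4 *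
     S 2 3 + S 1 4 * P 2 3) + P 2 4 * (Q 1 4 * P 2 3 - S 1 4 * R 2 3)) + S 1 3 * (R 2 4 *
     (Q 1 4 * Q 2 3 + S 1 4 * R 2 3 + R 1 4 * S 2 3 + P 1 4 * P 2 3) + Q 2 4 * (Q 1 4 *
     R 2 3 + R 1 4 * P 2 3) + P 2 4 * (Q 1 4 * R 2 3 + R 1 4 * P 2 3)) + P 1 3 * (R 2 4 *
     (Q 1 4 * S 2 3 + S 1 4 * P 2 3) + Q 2 4 * (Q 1 4 * P 2 3 - R 1 4 * S 2 3) + P 2 4 *
     (Q 1 4 * P 2 3 + P 1 4 * P 2 3))) + P 3 4 * (Q 1 3 * (Q 2 4 * (Q 1 4 * Q 2 3
     + S 1 4 * R 2 3) + R 2 4 * (S 1 4 * (Q 2 3 + P 2 3)) + P 2 4 * (Q 1 4 * (Q 2 3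
     + P 2 3) + P 1 4 * (Q 2 3 + P 2 3)) + S 2 4 * (Q 1 4 * R 2 3 + P 1 4 * R 2 3))
     + S 1 3 * (R 2 4 * (S 1 4 * R 2 3 - Q 1 4 * P 2 3) + P 2 4 * (Q 1 4 * R 2 3 + P 1 4 *
     R 2 3)) + R 1 3 * (P 2 4 * (S 1 4 * (Q 2 3 + P 2 3)) + S 2 4 * (S 1 4 * R 2 3
     - P 1 4 * Q 2 3)) + P 1 3 * (P 2 4 * (S 1 4 * R 2 3 + P 1 4 * P 2 3))) + S 3 4 *
     (S 1 3 * (R 2 4 * (Q 1 4 * R 2 3 + R 1 4 * P 2 3)) + Q 1 3 * (R 2 4 * (Q 1 4 * P 2 3
     - S 1 4 * R 2 3) + P 2 4 * (- Q 1 4 * R 2 3 - P 1 4 * R 2 3)) + P 1 3 * (R 2 4 *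
     (Q 1 4 * P 2 3 + P 1 4 * P 2 3) + P 2 4 * (R 1 4 * P 2 3 - P 1 4 * R 2 3)) + R 1 3 *
     (P 2 4 * (- S 1 4 * R 2 3 - P 1 4 * P 2 3)))) + P 1 2 * (R 3 4 * (S 1 3 * (Q 2 4 *
     (- Q 1 4 * Q 2 3 - R 1 4 * S 2 3)) + Q 1 3 * (Q 2 4 * (S 1 4 * Q 2 3 - Q 1 4 * S 2 3)
     + S 2 4 * (Q 1 4 * Q 2 3 + P 1 4 * Q 2 3)) + P 1 3 * (Q 2 4 * (- Q 1 4 * S 2 3
     - P 1 4 * S 2 3) + S 2 4 * (P 1 4 * Q 2 3 - R 1 4 * S 2 3)) + R 1 3 * (S 2 4 *
     (S 1 4 * Q 2 3 + P 1 4 * S 2 3))) + Q 3 4 * (Q 1 3 * (Q 2 4 * (Q 1 4 * Q 2 3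
     + R 1 4 * S 2 3)) + S 1 3 * (R 2 4 * (R 1 4 * S 2 3 - Q 1 4 * P 2 3) + Q 2 4 *
     (R 1 4 * (Q 2 3 + P 2 3))) + P 1 3 * (Q 2 4 * (Q 1 4 * (Q 2 3 + P 2 3) + P 1 4 *
     (Q 2 3 + P 2 3)) + R 2 4 * (Q 1 4 * S 2 3 + P 1 4 * S 2 3) + S 2 4 * (R 1 4 * (Q 2 3
     + P 2 3)) + P 2 4 * (R 1 4 * S 2 3 + P 1 4 * P 2 3)) + R 1 3 * (Q 2 4 * (Q 1 4 *
     S 2 3 + P 1 4 * S 2 3) + S 2 4 * (R 1 4 * S 2 3 - P 1 4 * Q 2 3))) + P 3 4 * (Q 1 3 *
     (Q 2 4 * (Q 1 4 * Q 2 3 + P 1 4 * Q 2 3) + P 2 4 * (P 1 4 * Q 2 3 - S 1 4 * R 2 3)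
     + S 2 4 * (R 1 4 * Q 2 3 + P 1 4 * R 2 3)) + R 1 3 * (Q 2 4 * (S 1 4 * Q 2 3
     + P 1 4 * S 2 3) + S 2 4 * (Q 1 4 * Q 2 3 + S 1 4 * R 2 3 + R 1 4 * S 2 3 + P 1 4 *
     P 2 3) + P 2 4 * (S 1 4 * Q 2 3 + P 1 4 * S 2 3)) + P 1 3 * (Q 2 4 * (P 1 4 * Q 2 3
     - R 1 4 * S 2 3) + S 2 4 * (R 1 4 * Q 2 3 + P 1 4 * R 2 3) + P 2 4 * (P 1 4 * (Q 2 3
     + P 2 3)))) + S 3 4 * (P 1 3 * (Q 2 4 * (R 1 4 * (Q 2 3 + P 2 3)) + R 2 4 * (R 1 4 *
     S 2 3 + P 1 4 * P 2 3) + P 2 4 * (R 1 4 * P 2 3 - P 1 4 * R 2 3)) + R 1 3 * (Q 2 4 *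
     (R 1 4 * S 2 3 - P 1 4 * Q 2 3) + S 2 4 * (- R 1 4 * Q 2 3 - P 1 4 * R 2 3) + P 2 4 *
     (P 1 4 * (- Q 2 3 - P 2 3))))) + R 1 2 * (Q 3 4 * (S 1 3 * (R 2 4 * (Q 1 4 * S 2 3
     + S 1 4 * P 2 3) + Q 2 4 * (Q 1 4 * P 2 3 - R 1 4 * S 2 3) + P 2 4 * (Q 1 4 * P 2 3
     + P 1 4 * P 2 3)) + P 1 3 * (Q 2 4 * (- Q 1 4 * S 2 3 - P 1 4 * S 2 3) + P 2 4 *
     (S 1 4 * P 2 3 - P 1 4 * S 2 3) + S 2 4 * (- R 1 4 * S 2 3 - P 1 4 * P 2 3)))
     + P 3 4 * (Q 1 3 * (P 2 4 * (S 1 4 * (Q 2 3 + P 2 3)) + S 2 4 * (S 1 4 * R 2 3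
     - P 1 4 * Q 2 3)) + S 1 3 * (P 2 4 * (S 1 4 * R 2 3 + P 1 4 * P 2 3)) + R 1 3 *
     (S 2 4 * (- S 1 4 * Q 2 3 - P 1 4 * S 2 3)) + P 1 3 * (P 2 4 * (S 1 4 * P 2 3
     - P 1 4 * S 2 3) + S 2 4 * (P 1 4 * (- Q 2 3 - P 2 3)))) + S 3 4 * (S 1 3 * (R 2 4 *
     (Q 1 4 * P 2 3 + P 1 4 * P 2 3) + P 2 4 * (R 1 4 * P 2 3 - P 1 4 * R 2 3)) + Q 1 3 *
     (P 2 4 * (- S 1 4 * R 2 3 - P 1 4 * P 2 3)) + P 1 3 * (R 2 4 * (S 1 4 * P 2 3
     - P 1 4 * S 2 3) + P 2 4 * (Q 1 4 * P 2 3 + P 1 4 * Q 2 3 - S 1 4 * R 2 3 - R 1 4 *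
     S 2 3) + Q 2 4 * (- R 1 4 * S 2 3 - P 1 4 * P 2 3) + S 2 4 * (P 1 4 * R 2 3 - R 1 4 *
     P 2 3)) + R 1 3 * (P 2 4 * (P 1 4 * S 2 3 - S 1 4 * P 2 3) + S 2 4 * (P 1 4 * (Q 2 3
     + P 2 3)))))"

lemma det_atiyah_matrix_expansion:
  "Determinant.det (atiyah_matrix \<alpha> \<beta>) =
    atiyah_expansion (\<lambda>i j. \<alpha> i j * cnj (\<alpha> i j)) (\<lambda>i j. \<beta> i j * cnj (\<beta> i j))
      (\<lambda>i j. \<alpha> i j * cnj (\<beta> i j)) (\<lambda>i j. \<beta> i j * cnj (\<alpha> i j))"
proof -
  have nums: "0 + 1 = (1::nat)" "1 + 1 = (2::nat)" "2 + 1 = (3::nat)" "3 + 1 = (4::nat)" by simp_all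
  have one: "coeff p 1 = coeff p (Suc 0)" for p :: "complex poly" by simp
  show ?thesis
    unfolding atiyah_matrix_def det_mat_4 prod.case nums atiyah_poly_products
    unfolding lin_form_def
    \<comment> \<open>Once the matrix entries are explicit, the coefficients and their conjugates
      can be treated as independent indeterminates; no geometric relation enters.\<close>
    by (simp only: if_True if_False one coeff_linear_product3 less_numeral_simps rel_simps)
      (unfold atiyah_expansion_def, Groebner_Basis.algebra)
qed

section \<open>Rotation of the polar axis\<close>

text \<open>An SU(2) substitution commutes with the antipodal map
  \<open>(\<alpha>, \<beta>) \<mapsto> (- cnj \<beta>, cnj \<alpha>)\<close>, so it acts in the same
  way on \<open>l_ij\<close> and \<open>l_ji\<close>. All rows are therefore multiplied by one
  symmetric cube, of determinant \<open>1^6\<close>.\<close>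

lemma det_atiyah_matrix_SU2:
  fixes \<alpha> \<beta> :: "nat \<Rightarrow> nat \<Rightarrow> complex" and \<alpha>\<^sub>0 \<beta>\<^sub>0 :: complex
  assumes unit: "\<alpha>\<^sub>0 * cnj \<alpha>\<^sub>0 + \<beta>\<^sub>0 * cnj \<beta>\<^sub>0 = 1"
  shows "Determinant.det (atiyah_matrix (\<lambda>i j. \<alpha> i j * \<beta>\<^sub>0 - \<beta> i j * \<alpha>\<^sub>0)
      (\<lambda>i j. \<alpha> i j * cnj \<alpha>\<^sub>0 + \<beta> i j * cnj \<beta>\<^sub>0)) = Determinant.det (atiyah_matrix \<alpha> \<beta>)"
proof -
  let ?\<alpha> = "\<lambda>i j. \<alpha> i j * \<beta>\<^sub>0 - \<beta> i j * \<alpha>\<^sub>0" and ?\<beta> = "\<lambda>i j. \<alpha> i j * cnj \<alpha>\<^sub>0 + \<beta> i j * cnj \<beta>\<^sub>0"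
  let ?S = "sym3 \<beta>\<^sub>0 (cnj \<alpha>\<^sub>0) (- \<alpha>\<^sub>0) (cnj \<beta>\<^sub>0)"
  \<comment> \<open>Uniform names for the coefficients of all forms, so that the antipodal ones need
    no separate treatment.\<close>
  define a where "a i j = (if i < j then \<alpha> i j else - cnj (\<beta> j i))" for i j
  define b where "b i j = (if i < j then \<beta> i j else cnj (\<alpha> j i))" for i j
  have form: "lin_form \<alpha> \<beta> i j = [:b i j, a i j:]" for i j
    by (simp add: lin_form_def a_def b_def)
  have form': "lin_form ?\<alpha> ?\<beta> i j =
      [:b i j * cnj \<beta>\<^sub>0 + a i j * cnj \<alpha>\<^sub>0, a i j * \<beta>\<^sub>0 + b i j * - \<alpha>\<^sub>0:]" for i j
    by (simp add: lin_form_def a_def b_def algebra_simps)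
  have row: "coeff (atiyah_poly ?\<alpha> ?\<beta> (i + 1)) j =
      (\<Sum>k<4. coeff (atiyah_poly \<alpha> \<beta> (i + 1)) k * ?S $$ (k, j))" if "i < 4" "j < 4" for i j
  proof -
    have nums: "0 + 1 = (1::nat)" "1 + 1 = (2::nat)" "2 + 1 = (3::nat)" "3 + 1 = (4::nat)" by simp_all
    consider "i = 0" | "i = 1" | "i = 2" | "i = 3" using \<open>i < 4\<close> by linarith
    then show ?thesis
      by cases (hypsubst, simp only: nums atiyah_poly_products form form'
          coeff_linear_product3_sym3[OF \<open>j < 4\<close>])+
  qed
  have S: "?S \<in> carrier_mat 4 4" and M: "atiyah_matrix \<alpha> \<beta> \<in> carrier_mat 4 4"
    by (simp_all add: sym3_def atiyah_matrix_def)
  have "atiyah_matrix ?\<alpha> ?\<beta> = atiyah_matrix \<alpha> \<beta> * ?S"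
    using S row by (intro eq_matI)
      (auto simp: atiyah_matrix_def scalar_prod_def atLeast0LessThan simp del: One_nat_def add_Suc_right)
  moreover have "Determinant.det ?S = 1"
    using unit by (simp add: det_sym3 algebra_simps)
  ultimately show ?thesis using det_mult[OF M S] by simp
qed

section \<open>Directions recovered from products of coefficients\<close>

text \<open>These products do not see the phase of the form, so they depend on its root alone; this
  is the Hopf map in coordinates.\<close>

lemma unit_form_products:
  fixes u :: "real^3"
  assumes form: "unit_form_root \<alpha> \<beta> (stereo u)" and u: "norm u = 1"
  shows "2 * (\<alpha> * cnj \<alpha>) = of_real (1 - u $ 3)"
    and "2 * (\<beta> * cnj \<beta>) = of_real (1 + u $ 3)"
    and "2 * (\<beta> * cnj \<alpha>) = - Complex (u $ 1) (u $ 2)"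
proof -
  have sphere: "(u $ 1)\<^sup>2 + (u $ 2)\<^sup>2 + (u $ 3)\<^sup>2 = 1"
    using u by (simp add: norm_eq_1 inner_vec_def sum_3 power2_eq_square)
  have unit: "(cmod \<alpha>)\<^sup>2 + (cmod \<beta>)\<^sup>2 = 1" using form by (simp add: unit_form_root_def)
  have *: "2 * (cmod \<alpha>)\<^sup>2 = 1 - u $ 3 \<and> 2 * (\<beta> * cnj \<alpha>) = - Complex (u $ 1) (u $ 2)"
  proof (cases "u $ 3 = 1")
    case True
    then have "(u $ 1)\<^sup>2 + (u $ 2)\<^sup>2 = 0" using sphere by simp
    then have "u $ 1 = 0" "u $ 2 = 0" by (simp_all add: sum_power2_eq_zero_iff)
    moreover have "\<alpha> = 0" using form True by (simp add: unit_form_root_def stereo_def)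
    ultimately show ?thesis using True by (simp add: complex_eq_iff)
  next
    case False
    \<comment> \<open>Away from the pole, \<open>sphere\<close> gives
      \<open>|t|^2 = (2 - k) / k\<close>, and the unit length of the form then forces
      \<open>2 |\<alpha>|^2 = k\<close>.\<close>
    define k where "k = 1 - u $ 3"
    have k: "k \<noteq> 0" using False by (simp add: k_def)
    define t where "t = Complex (u $ 1) (u $ 2) / of_real k"
    have \<beta>: "\<beta> = - (\<alpha> * t)"
      using form False
      by (simp add: unit_form_root_def stereo_def t_def k_def eq_neg_iff_add_eq_0 add.commute del: of_real_diff)
    have "(cmod t)\<^sup>2 = ((u $ 1)\<^sup>2 + (u $ 2)\<^sup>2) / k\<^sup>2"
      by (simp add: t_def norm_divide power_divide cmod_def add_divide_distrib)
    also have "(u $ 1)\<^sup>2 + (u $ 2)\<^sup>2 = k * (2 - k)"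
      using sphere by (simp add: k_def algebra_simps power2_eq_square)
    finally have "(cmod t)\<^sup>2 = (2 - k) / k" using k by (simp add: power2_eq_square)
    then have "1 + (cmod t)\<^sup>2 = 2 / k" using k by (simp add: field_simps)
    moreover have "(cmod \<alpha>)\<^sup>2 * (1 + (cmod t)\<^sup>2) = 1"
      using unit by (simp add: \<beta> norm_mult power_mult_distrib algebra_simps)
    ultimately have "(cmod \<alpha>)\<^sup>2 * (2 / k) = 1" by (simp only:)
    then have c: "2 * (cmod \<alpha>)\<^sup>2 = k" using k by (simp add: divide_eq_eq mult.commute)
    have "2 * (\<beta> * cnj \<alpha>) = - (of_real (2 * (cmod \<alpha>)\<^sup>2) * t)"
      unfolding \<beta> of_real_mult complex_norm_square by simp
    also have "\<dots> = - Complex (u $ 1) (u $ 2)" unfolding c using k by (simp add: t_def)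
    finally show ?thesis using c by (simp add: k_def)
  qed
  then show "2 * (\<beta> * cnj \<alpha>) = - Complex (u $ 1) (u $ 2)" by blast
  have "of_real (2 * (cmod \<alpha>)\<^sup>2) = complex_of_real (1 - u $ 3)" using * by simp
  then show "2 * (\<alpha> * cnj \<alpha>) = of_real (1 - u $ 3)"
    by (simp only: of_real_mult complex_norm_square of_real_numeral)
  have "of_real (2 * (cmod \<beta>)\<^sup>2) = complex_of_real (1 + u $ 3)"
    using * unit by (intro arg_cong[of _ _ of_real]) linarith
  then show "2 * (\<beta> * cnj \<beta>) = of_real (1 + u $ 3)"
    by (simp only: of_real_mult complex_norm_square of_real_numeral)
qed

text \<open>The coordinate of \<open>v\<close> in the plane orthogonal to the axis represented by the unit form
  \<open>(\<alpha>\<^sub>0, \<beta>\<^sub>0)\<close>, read as a complex number.\<close>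

definition planar :: "complex \<Rightarrow> complex \<Rightarrow> real^3 \<Rightarrow> complex" where
  "planar \<alpha>\<^sub>0 \<beta>\<^sub>0 v = 2 * of_real (v $ 3) * cnj \<alpha>\<^sub>0 * cnj \<beta>\<^sub>0
     + Complex (v $ 1) (v $ 2) * (cnj \<beta>\<^sub>0)\<^sup>2 - cnj (Complex (v $ 1) (v $ 2)) * (cnj \<alpha>\<^sub>0)\<^sup>2"

lemma planar_linear:
  "planar \<alpha>\<^sub>0 \<beta>\<^sub>0 (v + w) = planar \<alpha>\<^sub>0 \<beta>\<^sub>0 v + planar \<alpha>\<^sub>0 \<beta>\<^sub>0 w"
  "planar \<alpha>\<^sub>0 \<beta>\<^sub>0 (r *\<^sub>R v) = of_real r * planar \<alpha>\<^sub>0 \<beta>\<^sub>0 v"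
  by (simp_all add: planar_def Complex_eq algebra_simps)

text \<open>Here \<open>\<alpha>'\<close> is the determinant of the two forms and
  \<open>\<beta>'\<close> their Hermitian product. The substitution moves \<open>n\<close> to the
  north pole, so \<open>n \<bullet> u\<close> takes the place of the third coordinate.\<close>

lemma rotated_unit_form_products:
  fixes u n :: "real^3"
  assumes form0: "unit_form_root \<alpha>\<^sub>0 \<beta>\<^sub>0 (stereo n)" and n: "norm n = 1"
    and form: "unit_form_root \<alpha> \<beta> (stereo u)" and u: "norm u = 1"
  defines "\<alpha>' \<equiv> \<alpha> * \<beta>\<^sub>0 - \<beta> * \<alpha>\<^sub>0" and "\<beta>' \<equiv> \<alpha> * cnj \<alpha>\<^sub>0 + \<beta> * cnj \<beta>\<^sub>0"
  shows "2 * (\<alpha>' * cnj \<alpha>') = of_real (1 - n \<bullet> u)"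
    and "2 * (\<beta>' * cnj \<beta>') = of_real (1 + n \<bullet> u)"
    and "2 * (\<beta>' * cnj \<alpha>') = - planar \<alpha>\<^sub>0 \<beta>\<^sub>0 u"
proof -
  note f = unit_form_products[OF form u] and f0 = unit_form_products[OF form0 n]
  have fc: "2 * (\<alpha> * cnj \<beta>) = - cnj (Complex (u $ 1) (u $ 2))"
    using arg_cong[OF f(3), of cnj] by (simp add: mult.commute)
  have f0c: "2 * (\<alpha>\<^sub>0 * cnj \<beta>\<^sub>0) = - cnj (Complex (n $ 1) (n $ 2))"
    using arg_cong[OF f0(3), of cnj] by (simp add: mult.commute)
  have inner: "n \<bullet> u = n $ 1 * u $ 1 + n $ 2 * u $ 2 + n $ 3 * u $ 3"
    by (simp add: inner_vec_def sum_3)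
  have "2 * (\<alpha>' * cnj \<alpha>') = ((2 * (\<alpha> * cnj \<alpha>)) * (2 * (\<beta>\<^sub>0 * cnj \<beta>\<^sub>0))
      + (2 * (\<beta> * cnj \<beta>)) * (2 * (\<alpha>\<^sub>0 * cnj \<alpha>\<^sub>0))
      - (2 * (\<alpha> * cnj \<beta>)) * (2 * (\<beta>\<^sub>0 * cnj \<alpha>\<^sub>0)) - (2 * (\<beta> * cnj \<alpha>)) * (2 * (\<alpha>\<^sub>0 * cnj \<beta>\<^sub>0))) / 2"
    by (simp add: \<alpha>'_def algebra_simps)
  also have "\<dots> = of_real (1 - n \<bullet> u)"
    unfolding f f0 fc f0c inner by (simp add: complex_eq_iff field_simps)
  finally show "2 * (\<alpha>' * cnj \<alpha>') = of_real (1 - n \<bullet> u)" .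
  have "2 * (\<beta>' * cnj \<beta>') = ((2 * (\<alpha> * cnj \<alpha>)) * (2 * (\<alpha>\<^sub>0 * cnj \<alpha>\<^sub>0))
      + (2 * (\<beta> * cnj \<beta>)) * (2 * (\<beta>\<^sub>0 * cnj \<beta>\<^sub>0))
      + (2 * (\<alpha> * cnj \<beta>)) * (2 * (\<beta>\<^sub>0 * cnj \<alpha>\<^sub>0)) + (2 * (\<beta> * cnj \<alpha>)) * (2 * (\<alpha>\<^sub>0 * cnj \<beta>\<^sub>0))) / 2"
    by (simp add: \<beta>'_def algebra_simps)
  also have "\<dots> = of_real (1 + n \<bullet> u)"
    unfolding f f0 fc f0c inner by (simp add: complex_eq_iff field_simps)
  finally show "2 * (\<beta>' * cnj \<beta>') = of_real (1 + n \<bullet> u)" .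
  have "2 * (\<beta>' * cnj \<alpha>') = (2 * (\<alpha> * cnj \<alpha>)) * cnj \<alpha>\<^sub>0 * cnj \<beta>\<^sub>0
      + (2 * (\<beta> * cnj \<alpha>)) * (cnj \<beta>\<^sub>0)\<^sup>2
      - (2 * (\<alpha> * cnj \<beta>)) * (cnj \<alpha>\<^sub>0)\<^sup>2 - (2 * (\<beta> * cnj \<beta>)) * cnj \<alpha>\<^sub>0 * cnj \<beta>\<^sub>0"
    by (simp add: \<alpha>'_def \<beta>'_def algebra_simps power2_eq_square)
  also have "\<dots> = - planar \<alpha>\<^sub>0 \<beta>\<^sub>0 u"
    unfolding f fc planar_def by (simp add: algebra_simps)
  finally show "2 * (\<beta>' * cnj \<alpha>') = - planar \<alpha>\<^sub>0 \<beta>\<^sub>0 u" .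
qed

text \<open>Pythagoras for the part of \<open>v\<close> orthogonal to \<open>n\<close>. For a unit
  vector it is the identity \<open>|\<beta>' cnj \<alpha>'|^2 = |\<alpha>'|^2 |\<beta>'|^2\<close>,
  applied to any form with that root; the general case follows by scaling.\<close>

lemma planar_norm:
  fixes v n :: "real^3"
  assumes form0: "unit_form_root \<alpha>\<^sub>0 \<beta>\<^sub>0 (stereo n)" and n: "norm n = 1"
  shows "(cmod (planar \<alpha>\<^sub>0 \<beta>\<^sub>0 v))\<^sup>2 = (norm v)\<^sup>2 - (n \<bullet> v)\<^sup>2"
proof (cases "v = 0")
  case True
  then show ?thesis by (simp add: planar_def complex_eq_iff)
next
  case False
  define u where "u = (1 / norm v) *\<^sub>R v"
  have u: "norm u = 1" and v: "v = norm v *\<^sub>R u" using False by (simp_all add: u_def)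
  obtain \<alpha> \<beta> where form: "unit_form_root \<alpha> \<beta> (stereo u)" using unit_form_root_exists by blast
  define \<alpha>' where "\<alpha>' = \<alpha> * \<beta>\<^sub>0 - \<beta> * \<alpha>\<^sub>0"
  define \<beta>' where "\<beta>' = \<alpha> * cnj \<alpha>\<^sub>0 + \<beta> * cnj \<beta>\<^sub>0"
  note p = rotated_unit_form_products[OF form0 n form u, folded \<alpha>'_def \<beta>'_def]
  have "of_real ((cmod (planar \<alpha>\<^sub>0 \<beta>\<^sub>0 u))\<^sup>2) = (2 * (\<beta>' * cnj \<alpha>')) * cnj (2 * (\<beta>' * cnj \<alpha>'))"
    unfolding p(3) complex_norm_square by simp
  also have "\<dots> = (2 * (\<alpha>' * cnj \<alpha>')) * (2 * (\<beta>' * cnj \<beta>'))" by simp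
  also have "\<dots> = of_real (1 - (n \<bullet> u)\<^sup>2)"
    unfolding p by (simp add: algebra_simps power2_eq_square)
  finally have *: "(cmod (planar \<alpha>\<^sub>0 \<beta>\<^sub>0 u))\<^sup>2 = 1 - (n \<bullet> u)\<^sup>2" by (simp only: of_real_eq_iff)
  have "planar \<alpha>\<^sub>0 \<beta>\<^sub>0 v = of_real (norm v) * planar \<alpha>\<^sub>0 \<beta>\<^sub>0 u"
    using planar_linear(2) v by metis
  then have "(cmod (planar \<alpha>\<^sub>0 \<beta>\<^sub>0 v))\<^sup>2 = (norm v)\<^sup>2 * (1 - (n \<bullet> u)\<^sup>2)"
    by (simp add: norm_mult power_mult_distrib *)
  moreover have "n \<bullet> v = norm v * (n \<bullet> u)" using v by (metis inner_scaleR_right)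
  ultimately show ?thesis by (simp add: power_mult_distrib algebra_simps)
qed

section \<open>Wedge tetrahedra\<close>

lemma atiyah_expansion_cong:
  assumes "\<And>i j. (i, j) \<in> pairs4 \<Longrightarrow> P i j = P' i j" "\<And>i j. (i, j) \<in> pairs4 \<Longrightarrow> Q i j = Q' i j"
    "\<And>i j. (i, j) \<in> pairs4 \<Longrightarrow> R i j = R' i j" "\<And>i j. (i, j) \<in> pairs4 \<Longrightarrow> S i j = S' i j"
  shows "atiyah_expansion P Q R S = atiyah_expansion P' Q' R' S'"
proof -
  have "(1, 2) \<in> pairs4" "(1, 3) \<in> pairs4" "(1, 4) \<in> pairs4" "(2, 3) \<in> pairs4"
    "(2, 4) \<in> pairs4" "(3, 4) \<in> pairs4" by (simp_all add: pairs4_def)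
  then show ?thesis unfolding atiyah_expansion_def by (simp only: assms)
qed

lemma pairs4_eq: "pairs4 = {(1, 2), (1, 3), (1, 4), (2, 3), (2, 4), (3, 4)}"
  by (auto simp: pairs4_def)

text \<open>Every term has exactly one factor for each of the six pairs.\<close>

lemma atiyah_expansion_scale:
  fixes c P Q R S :: "nat \<Rightarrow> nat \<Rightarrow> 'a::idom"
  shows "atiyah_expansion (\<lambda>i j. c i j * P i j) (\<lambda>i j. c i j * Q i j)
      (\<lambda>i j. c i j * R i j) (\<lambda>i j. c i j * S i j) =
    (\<Prod>(i, j) \<in> pairs4. c i j) * atiyah_expansion P Q R S"
proof -
  have prod: "(\<Prod>(i, j) \<in> pairs4. c i j) = c 1 2 * c 1 3 * c 1 4 * c 2 3 * c 2 4 * c 3 4"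
    unfolding pairs4_eq by (simp add: mult.assoc)
  show ?thesis unfolding atiyah_expansion_def prod by Groebner_Basis.algebra
qed

text \<open>The primed variables stand for conjugates but stay independent, which makes this a
  polynomial identity. With \<open>Z = p + q\<close> and \<open>W = q - p\<close> for the edges 12
  and 34, \<open>X\<close> and \<open>Y\<close> become \<open>|Z|^2\<close> and
  \<open>|W|^2\<close>, while \<open>e\<close> and \<open>e'\<close> become \<open>Z cnj W\<close>
  and its conjugate; mixed terms vanish because \<open>e * e' = X * Y\<close>. The factor 2 keeps
  the coefficients integral.\<close>

lemma atiyah_expansion_wedge:
  fixes a b x y g p q p' q' :: "'a::idom"
  assumes "P 1 2 = x" "Q 1 2 = x" "R 1 2 = - (p' + q')" "S 1 2 = - (p + q)"
    and "P 3 4 = y" "Q 3 4 = y" "R 3 4 = - (q' - p')" "S 3 4 = - (q - p)"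
    and "P 1 3 = a - g" "Q 1 3 = a + g" "R 1 3 = - p'" "S 1 3 = - p"
    and "P 2 4 = a - g" "Q 2 4 = a + g" "R 2 4 = p'" "S 2 4 = p"
    and "P 1 4 = b - g" "Q 1 4 = b + g" "R 1 4 = - q'" "S 1 4 = - q"
    and "P 2 3 = b - g" "Q 2 3 = b + g" "R 2 3 = q'" "S 2 3 = q"
  defines "X \<equiv> (p + q) * (p' + q')" and "Y \<equiv> (q - p) * (q' - p')"
    and "e \<equiv> (p + q) * (q' - p')" and "e' \<equiv> (q - p) * (p' + q')"
  defines "K1 \<equiv> \<lambda>g. (a - b) * ((X + Y) * (a + b + g) + 4 * a * b * (x + y - g) - 4 * g * x * y
      + 4 * g\<^sup>2 * (x + y) - 4 * g ^ 3 + 2 * (a + b) * g * (x + y) - 4 * (a + b) * g\<^sup>2)"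
    and "K2 \<equiv> \<lambda>g. 2 * (a - b)\<^sup>2 - x * y - 4 * g\<^sup>2 - 2 * (a + b - x - y) * g"
  shows "2 * atiyah_expansion P Q R S =
    4 * X * Y * ((a + b)\<^sup>2 + 2 * g\<^sup>2) + 16 * (X * y + Y * x) * (a + b) * (a * b + g\<^sup>2)
    - 8 * (X + Y) * g\<^sup>2 * x * y + (X\<^sup>2 + Y\<^sup>2) * x * y
    + 16 * x * y * (4 * a * b * g\<^sup>2 + 3 * a\<^sup>2 * b\<^sup>2 + g ^ 4)
    + 2 * K1 g * e + 2 * K1 (- g) * e' + K2 g * e\<^sup>2 + K2 (- g) * e'\<^sup>2"
  unfolding atiyah_expansion_def assms
  by Groebner_Basis.algebra

lemma atiyah_D4_eq_expansion:
  fixes X :: "nat \<Rightarrow> real^3" and n :: "real^3"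
  assumes inj: "inj_on X {1..4}" and forms: "admissible_forms X \<alpha> \<beta>"
    and form0: "unit_form_root \<alpha>\<^sub>0 \<beta>\<^sub>0 (stereo n)" and n: "norm n = 1"
  shows "atiyah_D4 X \<alpha> \<beta> = atiyah_expansion
    (\<lambda>i j. of_real (edge X i j - n \<bullet> (X j - X i))) (\<lambda>i j. of_real (edge X i j + n \<bullet> (X j - X i)))
    (\<lambda>i j. - cnj (planar \<alpha>\<^sub>0 \<beta>\<^sub>0 (X j - X i))) (\<lambda>i j. - planar \<alpha>\<^sub>0 \<beta>\<^sub>0 (X j - X i))"
    (is "_ = atiyah_expansion ?P ?Q ?R ?S")
proof -
  define \<alpha>' where "\<alpha>' = (\<lambda>i j. \<alpha> i j * \<beta>\<^sub>0 - \<beta> i j * \<alpha>\<^sub>0)"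
  define \<beta>' where "\<beta>' = (\<lambda>i j. \<alpha> i j * cnj \<alpha>\<^sub>0 + \<beta> i j * cnj \<beta>\<^sub>0)"
  \<comment> \<open>The prefactor \<open>64\<close> times the product of the edges is split as one
    factor \<open>2 r_ij\<close> per pair, which turns unit directions into differences of
    points.\<close>
  define c :: "nat \<Rightarrow> nat \<Rightarrow> complex" where "c = (\<lambda>i j. 2 * of_real (edge X i j))"
  have entries: "c i j * (\<alpha>' i j * cnj (\<alpha>' i j)) = ?P i j" "c i j * (\<beta>' i j * cnj (\<beta>' i j)) = ?Q i j"
    "c i j * (\<alpha>' i j * cnj (\<beta>' i j)) = ?R i j" "c i j * (\<beta>' i j * cnj (\<alpha>' i j)) = ?S i j"
    if ij: "(i, j) \<in> pairs4" for i j
  proof -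
    define r where "r = edge X i j"
    define u where "u = (1 / r) *\<^sub>R (X j - X i)"
    have "i \<in> {1..4}" "j \<in> {1..4}" "i \<noteq> j" using ij by (auto simp: pairs4_def)
    then have "X i \<noteq> X j" using inj by (metis inj_onD)
    then have r: "r > 0" by (simp add: r_def edge_def)
    have u: "norm u = 1"
      using r by (simp add: u_def r_def edge_def dist_norm norm_minus_commute)
    have v: "X j - X i = r *\<^sub>R u" using r by (simp add: u_def)
    have "unit_form_root (\<alpha> i j) (\<beta> i j) (stereo u)"
      using forms ij by (auto simp: admissible_forms_def direction_pt_def u_def r_def)
    note p = rotated_unit_form_products[OF form0 n this u]
    have split: "c i j * z = of_real r * (2 * z)" for z by (simp add: c_def r_def)
    show P: "c i j * (\<alpha>' i j * cnj (\<alpha>' i j)) = ?P i j"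
      unfolding split v r_def[symmetric] \<alpha>'_def p by (simp add: algebra_simps)
    show "c i j * (\<beta>' i j * cnj (\<beta>' i j)) = ?Q i j"
      unfolding split v r_def[symmetric] \<beta>'_def p by (simp add: algebra_simps)
    show S: "c i j * (\<beta>' i j * cnj (\<alpha>' i j)) = ?S i j"
      unfolding split v r_def[symmetric] \<alpha>'_def \<beta>'_def p by (simp add: planar_linear)
    show "c i j * (\<alpha>' i j * cnj (\<beta>' i j)) = ?R i j"
      using arg_cong[OF S, of cnj] by (simp add: c_def mult.commute)
  qed
  have "(cmod \<alpha>\<^sub>0)\<^sup>2 + (cmod \<beta>\<^sub>0)\<^sup>2 = 1" using form0 by (simp add: unit_form_root_def)
  then have "\<alpha>\<^sub>0 * cnj \<alpha>\<^sub>0 + \<beta>\<^sub>0 * cnj \<beta>\<^sub>0 = 1"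
    by (metis complex_norm_square of_real_1 of_real_add)
  then have det: "Determinant.det (atiyah_matrix \<alpha> \<beta>) = Determinant.det (atiyah_matrix \<alpha>' \<beta>')"
    unfolding \<alpha>'_def \<beta>'_def by (rule det_atiyah_matrix_SU2[symmetric])
  have "(\<Prod>(i, j) \<in> pairs4. c i j) = 64 * of_real (\<Prod>(i, j) \<in> pairs4. edge X i j)"
    unfolding pairs4_eq by (simp add: c_def)
  then have "atiyah_D4 X \<alpha> \<beta> =
      (\<Prod>(i, j) \<in> pairs4. c i j) * Determinant.det (atiyah_matrix \<alpha> \<beta>)"
    by (simp add: atiyah_D4_def atiyah_matrix_def)
  also have "\<dots> = atiyah_expansion
      (\<lambda>i j. c i j * (\<alpha>' i j * cnj (\<alpha>' i j))) (\<lambda>i j. c i j * (\<beta>' i j * cnj (\<beta>' i j)))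
      (\<lambda>i j. c i j * (\<alpha>' i j * cnj (\<beta>' i j))) (\<lambda>i j. c i j * (\<beta>' i j * cnj (\<alpha>' i j)))"
    unfolding det by (simp only: det_atiyah_matrix_expansion atiyah_expansion_scale)
  also have "\<dots> = atiyah_expansion ?P ?Q ?R ?S"
    by (rule atiyah_expansion_cong) (simp_all only: entries)
  finally show ?thesis .
qed

section \<open>The axis of the half-turn and the volume\<close>

text \<open>In the application \<open>k\<close> joins the midpoints of the edges 12 and 34. If they
  coincide, \<open>k\<close> gives no direction, and any common normal of \<open>p\<close> and
  \<open>w\<close> serves as the axis.\<close>

lemma wedge_axis_exists:
  fixes p w k :: "real^3"
  assumes "p \<bullet> k = 0" "w \<bullet> k = 0"
  obtains n where "norm n = 1" "n \<bullet> p = 0" "n \<bullet> w = 0" "k = (n \<bullet> k) *\<^sub>R n"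
proof -
  obtain m where m: "m \<noteq> 0" "m \<bullet> p = 0" "m \<bullet> w = 0" "k = 0 \<or> m = k"
  proof (cases "k = 0")
    case True
    have "dim {p, w} \<le> card {p, w}" by (rule dim_le_card') simp
    also have "\<dots> \<le> 2" by (simp add: card_insert_if)
    finally have "dim {p, w} < DIM(real^3)" by simp
    then obtain m where "m \<noteq> 0" "\<And>y. y \<in> span {p, w} \<Longrightarrow> real_inner_class.orthogonal m y"
      by (rule orthogonal_to_subspace_exists) blast
    then show ?thesis using that[of m] True by (simp add: real_inner_class.orthogonal_def span_base)
  next
    case False
    then show ?thesis using that[of k] assms by (simp add: inner_commute)
  qed
  define n where "n = (1 / norm m) *\<^sub>R m"
  have "k = (n \<bullet> k) *\<^sub>R n"
    using m by (auto simp: n_def dot_square_norm power2_eq_square)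
  then show ?thesis using that[of n] m by (simp add: n_def)
qed

text \<open>The edges 13, 24 are \<open>k \<plusminus> (p - w)/2\<close> and the edges 14, 23 are
  \<open>k \<plusminus> (p + w)/2\<close>. Equal lengths within each pair make \<open>k\<close>
  orthogonal to \<open>p - w\<close> and \<open>p + w\<close>; comparing and adding the two squared
  lengths gives the rest.\<close>

lemma wedge_frame:
  fixes X :: "nat \<Rightarrow> real^3"
  assumes a: "edge X 1 3 = a" "edge X 2 4 = a" and b: "edge X 2 3 = b" "edge X 1 4 = b"
  defines "p \<equiv> X 2 - X 1" and "w \<equiv> X 4 - X 3"
    and "k \<equiv> (1/2) *\<^sub>R (X 3 + X 4 - X 1 - X 2)"
  shows "p \<bullet> k = 0" "w \<bullet> k = 0" "p \<bullet> w = b\<^sup>2 - a\<^sup>2"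
    and "4 * (k \<bullet> k) = 2 * a\<^sup>2 + 2 * b\<^sup>2 - p \<bullet> p - w \<bullet> w"
proof -
  have sq: "(edge X i j)\<^sup>2 = (X i - X j) \<bullet> (X i - X j)" for i j
    by (simp add: edge_def dist_norm dot_square_norm)
  note eqs = sq[of 1 3, unfolded a] sq[of 2 4, unfolded a] sq[of 2 3, unfolded b] sq[of 1 4, unfolded b]
  show "p \<bullet> k = 0" "w \<bullet> k = 0" "p \<bullet> w = b\<^sup>2 - a\<^sup>2"
    "4 * (k \<bullet> k) = 2 * a\<^sup>2 + 2 * b\<^sup>2 - p \<bullet> p - w \<bullet> w"
    using eqs by (simp_all add: p_def w_def k_def inner_commute algebra_simps)
qed

lemma tetra_volume_det:
  fixes X :: "nat \<Rightarrow> real^3"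
  assumes inj: "inj_on X {1..4}"
  shows "6 * tetra_volume X =
    \<bar>Determinants.det (\<chi> i j. (if j = 1 then X 2 else if j = 2 then X 3 else X 4) $ i - X 1 $ i)\<bar>"
proof -
  let ?f = "\<lambda>j::3. if j = 1 then X 2 else if j = 2 then X 3 else X 4"
  have idx: "{1..4} = {1, 2, 3, 4::nat}" by auto
  have ne: "X 1 \<noteq> X 2" "X 1 \<noteq> X 3" "X 1 \<noteq> X 4" "X 2 \<noteq> X 3" "X 2 \<noteq> X 4" "X 3 \<noteq> X 4"
    using inj unfolding idx by (auto simp: inj_on_def)
  have "range ?f = X ` {1..4} - {X 1}"
    unfolding UNIV_3 idx using ne by auto
  moreover have "inj ?f"
    using ne by (auto simp: inj_on_def) (metis exhaust_3)+
  ultimately have bij: "bij_betw ?f UNIV (X ` {1..4} - {X 1})" by (simp add: bij_betw_def)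
  \<comment> \<open>The hull of finitely many points is compact, hence Borel, so both measures agree
    on it.\<close>
  have "tetra_volume X = measure lborel (convex hull (X ` {1..4}))"
    unfolding tetra_volume_def
    by (rule measure_completion) (simp add: compact_imp_closed finite_imp_compact_convex_hull borel_closed)
  also have "\<dots> = \<bar>Determinants.det (\<chi> i j. ?f j $ i - X 1 $ i)\<bar> / fact CARD(3)"
    by (rule content_simplex) (use inj bij in \<open>auto simp: card_image\<close>)
  finally show ?thesis by (simp add: fact_numeral)
qed

text \<open>Column operations turn the determinant of the edge vectors at point 1 into the triple
  product \<open>D\<close> of \<open>p\<close>, \<open>k\<close>, \<open>w\<close>. Its square is
  their Gram determinant, where orthogonality to \<open>k\<close> removes the cross terms.\<close>

lemma wedge_volume:
  fixes X :: "nat \<Rightarrow> real^3"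
  assumes inj: "inj_on X {1..4}"
  defines "p \<equiv> X 2 - X 1" and "w \<equiv> X 4 - X 3"
    and "k \<equiv> (1/2) *\<^sub>R (X 3 + X 4 - X 1 - X 2)"
  assumes "p \<bullet> k = 0" "w \<bullet> k = 0"
  shows "36 * (tetra_volume X)\<^sup>2 = (k \<bullet> k) * ((p \<bullet> p) * (w \<bullet> w) - (p \<bullet> w)\<^sup>2)"
proof -
  define D where "D = p$1 * (k$2 * w$3 - k$3 * w$2) - p$2 * (k$1 * w$3 - k$3 * w$1)
    + p$3 * (k$1 * w$2 - k$2 * w$1)"
  have "Determinants.det (\<chi> i j. (if j = 1 then X 2 else if j = 2 then X 3 else X 4) $ i - X 1 $ i) = D"
    by (simp add: det_3 D_def p_def w_def k_def field_simps)
  then have "36 * (tetra_volume X)\<^sup>2 = D\<^sup>2"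
    using arg_cong[OF tetra_volume_det[OF inj], of "\<lambda>t. t\<^sup>2"] by (simp add: power_mult_distrib)
  also have "\<dots> = (p \<bullet> p) * (w \<bullet> w) * (k \<bullet> k) + 2 * (p \<bullet> w) * (w \<bullet> k) * (p \<bullet> k)
      - (p \<bullet> p) * (w \<bullet> k)\<^sup>2 - (w \<bullet> w) * (p \<bullet> k)\<^sup>2 - (k \<bullet> k) * (p \<bullet> w)\<^sup>2"
    unfolding D_def inner_vec_def sum_3 inner_real_def by Groebner_Basis.algebra
  finally show ?thesis using assms(5,6) by (simp add: algebra_simps)
qed

section \<open>The formula for the real part\<close>

text \<open>The left side is twice the real part of the wedge expansion, with
  \<open>Re e = b\<^sup>2 - a\<^sup>2\<close> and \<open>|e| = x y\<close> inserted. The last term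
  on the right is twice the volume term, \<open>576 V^2\<close>.\<close>

lemma wedge_identity:
  fixes a b x y g :: real
  assumes "4 * g\<^sup>2 = 2 * a\<^sup>2 + 2 * b\<^sup>2 - x\<^sup>2 - y\<^sup>2"
  defines "K1 \<equiv> \<lambda>g. (a - b) * ((x\<^sup>2 + y\<^sup>2) * (a + b + g) + 4 * a * b * (x + y - g) - 4 * g * x * y
      + 4 * g\<^sup>2 * (x + y) - 4 * g ^ 3 + 2 * (a + b) * g * (x + y) - 4 * (a + b) * g\<^sup>2)"
    and "K2 \<equiv> \<lambda>g. 2 * (a - b)\<^sup>2 - x * y - 4 * g\<^sup>2 - 2 * (a + b - x - y) * g"
  shows "4 * x\<^sup>2 * y\<^sup>2 * ((a + b)\<^sup>2 + 2 * g\<^sup>2) + 16 * (x\<^sup>2 * y + y\<^sup>2 * x) * (a + b) * (a * b + g\<^sup>2)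
      - 8 * (x\<^sup>2 + y\<^sup>2) * g\<^sup>2 * x * y + ((x\<^sup>2)\<^sup>2 + (y\<^sup>2)\<^sup>2) * x * y
      + 16 * x * y * (4 * a * b * g\<^sup>2 + 3 * a\<^sup>2 * b\<^sup>2 + g ^ 4)
      + 2 * (K1 g + K1 (- g)) * (b\<^sup>2 - a\<^sup>2)
      + (K2 g + K2 (- g)) * (2 * (b\<^sup>2 - a\<^sup>2)\<^sup>2 - x\<^sup>2 * y\<^sup>2) =
    2 * ((d3 a b x + 8 * a * b * x) * (d3 a b y + 8 * a * b * y) + d3 a b x * d3 a b y
        + 2 * x * ((a + b)\<^sup>2 - y\<^sup>2) * d3 a b y + 2 * y * ((a + b)\<^sup>2 - x\<^sup>2) * d3 a b x
        + 4 * (a\<^sup>2 + b\<^sup>2 - x * y) * (2 * a\<^sup>2 + 2 * b\<^sup>2 - x\<^sup>2 - y\<^sup>2) * (a - b)\<^sup>2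
        + 2 * (x * y - (a - b)\<^sup>2) * (x\<^sup>2 - (a - b)\<^sup>2) * (y\<^sup>2 - (a - b)\<^sup>2))
    + 16 * g\<^sup>2 * (x\<^sup>2 * y\<^sup>2 - (b\<^sup>2 - a\<^sup>2)\<^sup>2)"
  unfolding K1_def K2_def d3_def using assms(1) by Groebner_Basis.algebra

text \<open>The last two claims supply the inequalities: \<open>288 V^2\<close> in terms of the
  edges, and the sign of \<open>4 g\<^sup>2\<close>.\<close>

lemma wedge_Re_atiyah_D4:
  fixes X :: "nat \<Rightarrow> real^3"
  assumes inj: "inj_on X {1..4}" and forms: "admissible_forms X \<alpha> \<beta>"
    and a: "edge X 1 3 = a" "edge X 2 4 = a" and b: "edge X 2 3 = b" "edge X 1 4 = b"
    and x: "edge X 1 2 = x" and y: "edge X 3 4 = y"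
  shows "Re (atiyah_D4 X \<alpha> \<beta>) =
      (d3 a b x + 8 * a * b * x) * (d3 a b y + 8 * a * b * y) + d3 a b x * d3 a b y
      + 2 * x * ((a + b)\<^sup>2 - y\<^sup>2) * d3 a b y + 2 * y * ((a + b)\<^sup>2 - x\<^sup>2) * d3 a b x
      + 4 * (a\<^sup>2 + b\<^sup>2 - x * y) * (2 * a\<^sup>2 + 2 * b\<^sup>2 - x\<^sup>2 - y\<^sup>2) * (a - b)\<^sup>2
      + 2 * (x * y - (a - b)\<^sup>2) * (x\<^sup>2 - (a - b)\<^sup>2) * (y\<^sup>2 - (a - b)\<^sup>2)
      + 288 * (tetra_volume X)\<^sup>2" (is ?formula)
    and "144 * (tetra_volume X)\<^sup>2 =
      (2 * a\<^sup>2 + 2 * b\<^sup>2 - x\<^sup>2 - y\<^sup>2) * (x\<^sup>2 * y\<^sup>2 - (b\<^sup>2 - a\<^sup>2)\<^sup>2)" (is ?volume)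
    and "2 * a\<^sup>2 + 2 * b\<^sup>2 - x\<^sup>2 - y\<^sup>2 \<ge> 0" (is ?nonneg)
proof -
  define p where "p = X 2 - X 1"
  define w where "w = X 4 - X 3"
  define k where "k = (1/2) *\<^sub>R (X 3 + X 4 - X 1 - X 2)"
  note frame = wedge_frame[OF a b, folded p_def w_def k_def]
  have pp: "p \<bullet> p = x\<^sup>2" and ww: "w \<bullet> w = y\<^sup>2"
    using x y by (simp_all add: p_def w_def edge_def dist_norm dot_square_norm norm_minus_commute)
  obtain n where n: "norm n = 1" "n \<bullet> p = 0" "n \<bullet> w = 0" "k = (n \<bullet> k) *\<^sub>R n"
    using wedge_axis_exists[OF frame(1,2)] .
  define g where "g = n \<bullet> k"
  have k: "k = g *\<^sub>R n" using n(4) by (simp add: g_def)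
  have "k \<bullet> k = g\<^sup>2" using n(1) by (simp add: k dot_square_norm power2_eq_square)
  then have g: "4 * g\<^sup>2 = 2 * a\<^sup>2 + 2 * b\<^sup>2 - x\<^sup>2 - y\<^sup>2" using frame(4) pp ww by simp
  then show ?nonneg by (metis zero_le_power2 mult_nonneg_nonneg zero_le_numeral)
  have vol: "36 * (tetra_volume X)\<^sup>2 = g\<^sup>2 * (x\<^sup>2 * y\<^sup>2 - (b\<^sup>2 - a\<^sup>2)\<^sup>2)"
    using wedge_volume[OF inj] frame pp ww \<open>k \<bullet> k = g\<^sup>2\<close> by (simp add: p_def w_def k_def)
  then show ?volume unfolding g[symmetric] by simp

  obtain \<alpha>\<^sub>0 \<beta>\<^sub>0 where form0: "unit_form_root \<alpha>\<^sub>0 \<beta>\<^sub>0 (stereo n)" using unit_form_root_exists by blast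
  let ?\<zeta> = "planar \<alpha>\<^sub>0 \<beta>\<^sub>0"
  note planar_norm = planar_norm[OF form0 n(1)]
  have "(cmod (?\<zeta> n))\<^sup>2 = 0" unfolding planar_norm using n(1) by (simp add: dot_square_norm)
  then have \<zeta>k: "?\<zeta> k = 0" by (simp add: k planar_linear)
  \<comment> \<open>As \<open>k\<close> has no planar part, the edges 13 and 24 get opposite planar
    coordinates, and so do 14 and 23; this is the half-turn symmetry.\<close>
  define P where "P = ?\<zeta> ((1/2) *\<^sub>R (p - w))"
  define Q where "Q = ?\<zeta> ((1/2) *\<^sub>R (p + w))"
  have diffs:
    "X 2 - X 1 = (1/2) *\<^sub>R (p - w) + (1/2) *\<^sub>R (p + w)"
    "X 4 - X 3 = (1/2) *\<^sub>R (p + w) + (-1) *\<^sub>R ((1/2) *\<^sub>R (p - w))"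
    "X 3 - X 1 = k + (1/2) *\<^sub>R (p - w)" "X 4 - X 2 = k + (-1) *\<^sub>R ((1/2) *\<^sub>R (p - w))"
    "X 4 - X 1 = k + (1/2) *\<^sub>R (p + w)" "X 3 - X 2 = k + (-1) *\<^sub>R ((1/2) *\<^sub>R (p + w))"
    by (simp_all add: p_def w_def k_def vec_eq_iff field_simps)
  have \<zeta>: "?\<zeta> (X 2 - X 1) = P + Q" "?\<zeta> (X 4 - X 3) = Q - P" "?\<zeta> (X 3 - X 1) = P"
    "?\<zeta> (X 4 - X 2) = - P" "?\<zeta> (X 4 - X 1) = Q" "?\<zeta> (X 3 - X 2) = - Q"
    unfolding diffs planar_linear(1) planar_linear(2)[of _ _ "-1"] \<zeta>k
    by (simp_all add: P_def Q_def)
  have height: "n \<bullet> (X 2 - X 1) = 0" "n \<bullet> (X 4 - X 3) = 0" "n \<bullet> (X 3 - X 1) = g"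
    "n \<bullet> (X 4 - X 2) = g" "n \<bullet> (X 4 - X 1) = g" "n \<bullet> (X 3 - X 2) = g"
    unfolding diffs using n(2,3) by (simp_all add: g_def inner_add_right inner_diff_right)
  have sqx: "(cmod (P + Q))\<^sup>2 = x\<^sup>2" and sqy: "(cmod (Q - P))\<^sup>2 = y\<^sup>2"
    unfolding \<zeta>(1,2)[symmetric] planar_norm height
    using pp ww by (simp_all add: p_def w_def dot_square_norm)
  have sqa: "(cmod P)\<^sup>2 = a\<^sup>2 - g\<^sup>2" and sqb: "(cmod Q)\<^sup>2 = b\<^sup>2 - g\<^sup>2"
    unfolding \<zeta>(3,5)[symmetric] planar_norm height
    using a(1) b(2) by (simp_all add: edge_def dist_norm norm_minus_commute)
  have XX: "(P + Q) * (cnj P + cnj Q) = of_real (x\<^sup>2)" and YY: "(Q - P) * (cnj Q - cnj P) = of_real (y\<^sup>2)"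
    unfolding sqx[symmetric] sqy[symmetric] complex_norm_square by simp_all
  define e where "e = (P + Q) * (cnj Q - cnj P)"
  have cnj_e: "(Q - P) * (cnj P + cnj Q) = cnj e" by (simp add: e_def mult.commute)
  \<comment> \<open>The real part of \<open>(P + Q) * cnj (Q - P)\<close> is
    \<open>|Q|^2 - |P|^2\<close>, in which the height \<open>g\<close> cancels.\<close>
  have Re_e: "Re e = b\<^sup>2 - a\<^sup>2"
    using sqa sqb by (simp add: e_def cmod_power2 algebra_simps) (simp add: power2_eq_square)
  have "(cmod e)\<^sup>2 = (cmod (P + Q))\<^sup>2 * (cmod (Q - P))\<^sup>2"
    unfolding e_def complex_cnj_diff[symmetric] norm_mult complex_mod_cnj by (simp add: power_mult_distrib)
  then have Im_e: "(Im e)\<^sup>2 = x\<^sup>2 * y\<^sup>2 - (b\<^sup>2 - a\<^sup>2)\<^sup>2"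
    unfolding sqx sqy cmod_power2[of e] Re_e by simp

  define K0 where "K0 = 4 * x\<^sup>2 * y\<^sup>2 * ((a + b)\<^sup>2 + 2 * g\<^sup>2)
      + 16 * (x\<^sup>2 * y + y\<^sup>2 * x) * (a + b) * (a * b + g\<^sup>2)
      - 8 * (x\<^sup>2 + y\<^sup>2) * g\<^sup>2 * x * y + ((x\<^sup>2)\<^sup>2 + (y\<^sup>2)\<^sup>2) * x * y
      + 16 * x * y * (4 * a * b * g\<^sup>2 + 3 * a\<^sup>2 * b\<^sup>2 + g ^ 4)"
  define K1 where "K1 = (\<lambda>g. (a - b) * ((x\<^sup>2 + y\<^sup>2) * (a + b + g) + 4 * a * b * (x + y - g)
      - 4 * g * x * y + 4 * g\<^sup>2 * (x + y) - 4 * g ^ 3 + 2 * (a + b) * g * (x + y) - 4 * (a + b) * g\<^sup>2))"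
  define K2 where "K2 = (\<lambda>g. 2 * (a - b)\<^sup>2 - x * y - 4 * g\<^sup>2 - 2 * (a + b - x - y) * g)"
  have "2 * atiyah_D4 X \<alpha> \<beta> = of_real K0 + 2 * of_real (K1 g) * e + 2 * of_real (K1 (- g)) * cnj e
      + of_real (K2 g) * e\<^sup>2 + of_real (K2 (- g)) * (cnj e)\<^sup>2"
    unfolding atiyah_D4_eq_expansion[OF inj forms form0 n(1)]
    by (rule trans[OF atiyah_expansion_wedge[where x = "of_real x" and y = "of_real y"
          and a = "of_real a" and b = "of_real b" and g = "of_real g"
          and p = P and q = Q and p' = "cnj P" and q' = "cnj Q"]],
        unfold \<zeta> height a b x y XX YY cnj_e e_def[symmetric])
      (simp_all add: K0_def K1_def K2_def)
  \<comment> \<open>All coefficients are real and \<open>e\<close>, \<open>cnj e\<close> share their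
    real part, so \<open>Im e\<close> enters only through its square.\<close>
  then have "2 * Re (atiyah_D4 X \<alpha> \<beta>) = K0 + 2 * (K1 g + K1 (- g)) * Re e
      + (K2 g + K2 (- g)) * ((Re e)\<^sup>2 - (Im e)\<^sup>2)"
    by (drule_tac arg_cong[of _ _ Re]) (simp add: algebra_simps power2_eq_square)
  also have "(Re e)\<^sup>2 - (Im e)\<^sup>2 = 2 * (b\<^sup>2 - a\<^sup>2)\<^sup>2 - x\<^sup>2 * y\<^sup>2" by (simp add: Re_e Im_e)
  finally show ?formula
    unfolding Re_e K0_def K1_def K2_def wedge_identity[OF g] using vol by simp
qed

section \<open>Lower bounds for the remaining terms\<close>

text \<open>The third claim yields the bound that keeps the volume. The fourth adds
  \<open>288 V^2\<close>, expressed by the edges, and yields the bound with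
  \<open>3 * d3 a b x * d3 a b y\<close>.\<close>

lemma wedge_remainder_nonneg:
  fixes a b x y :: real
  assumes tri: "\<bar>a - b\<bar> \<le> x" "x \<le> a + b" "\<bar>a - b\<bar> \<le> y" "y \<le> a + b"
    and P: "2 * a\<^sup>2 + 2 * b\<^sup>2 - x\<^sup>2 - y\<^sup>2 \<ge> 0"
  shows "d3 a b x \<ge> 0" "d3 a b y \<ge> 0"
    and "2 * x * ((a + b)\<^sup>2 - y\<^sup>2) * d3 a b y + 2 * y * ((a + b)\<^sup>2 - x\<^sup>2) * d3 a b x
      + 4 * (a\<^sup>2 + b\<^sup>2 - x * y) * (2 * a\<^sup>2 + 2 * b\<^sup>2 - x\<^sup>2 - y\<^sup>2) * (a - b)\<^sup>2
      + 2 * (x * y - (a - b)\<^sup>2) * (x\<^sup>2 - (a - b)\<^sup>2) * (y\<^sup>2 - (a - b)\<^sup>2) \<ge> 0"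
    and "2 * x * ((a + b)\<^sup>2 - y\<^sup>2) * d3 a b y + 2 * y * ((a + b)\<^sup>2 - x\<^sup>2) * d3 a b x
      + 4 * (a\<^sup>2 + b\<^sup>2 - x * y) * (2 * a\<^sup>2 + 2 * b\<^sup>2 - x\<^sup>2 - y\<^sup>2) * (a - b)\<^sup>2
      + 2 * (x * y - (a - b)\<^sup>2) * (x\<^sup>2 - (a - b)\<^sup>2) * (y\<^sup>2 - (a - b)\<^sup>2)
      + 2 * (2 * a\<^sup>2 + 2 * b\<^sup>2 - x\<^sup>2 - y\<^sup>2) * (x\<^sup>2 * y\<^sup>2 - (b\<^sup>2 - a\<^sup>2)\<^sup>2)
      \<ge> 2 * d3 a b x * d3 a b y"
proof -
  define m where "m = a + b"
  define d where "d = (a - b)\<^sup>2"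
  define N where "N = 2 * a\<^sup>2 + 2 * b\<^sup>2 - x\<^sup>2 - y\<^sup>2"
  define p where "p = x\<^sup>2 - d"
  define q where "q = y\<^sup>2 - d"
  have x: "0 \<le> x" "x \<le> m" and y: "0 \<le> y" "y \<le> m" using tri by (auto simp: m_def)
  have p: "0 \<le> p" "p \<le> x\<^sup>2" and q: "0 \<le> q" "q \<le> y\<^sup>2"
    using tri x y abs_le_square_iff[of "a - b" x] abs_le_square_iff[of "a - b" y]
    by (auto simp: p_def q_def d_def)
  have d: "d \<ge> 0" "d \<le> x * y"
    using mult_mono[OF tri(1,3)] x by (auto simp: d_def power2_eq_square)
  have dx: "d3 a b x = (m - x) * p" and dy: "d3 a b y = (m - y) * q"
    by (simp_all add: d3_def m_def p_def q_def d_def algebra_simps power2_eq_square)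
  show "d3 a b x \<ge> 0" "d3 a b y \<ge> 0" using x y p q by (simp_all add: dx dy)
  have my: "m\<^sup>2 - y\<^sup>2 = (m + y) * (m - y)" and mx: "m\<^sup>2 - x\<^sup>2 = (m + x) * (m - x)"
    by (simp_all add: algebra_simps power2_eq_square)
  have N: "N \<ge> 0" using P by (simp add: N_def)
  \<comment> \<open>From \<open>2 x y \<le> x\<^sup>2 + y\<^sup>2 \<le> 2 a\<^sup>2 + 2
    b\<^sup>2\<close>.\<close>
  have xy: "a\<^sup>2 + b\<^sup>2 - x * y \<ge> 0"
    using P sum_squares_bound[of x y] by simp
  have E: "2 * x * ((a + b)\<^sup>2 - y\<^sup>2) * d3 a b y = 2 * (x * (m + y) * (m - y)\<^sup>2 * q)"
    "2 * y * ((a + b)\<^sup>2 - x\<^sup>2) * d3 a b x = 2 * (y * (m + x) * (m - x)\<^sup>2 * p)"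
    unfolding dx dy m_def[symmetric] mx my by (simp_all add: power2_eq_square)
  have E0: "0 \<le> x * (m + y) * (m - y)\<^sup>2 * q" "0 \<le> y * (m + x) * (m - x)\<^sup>2 * p"
    "0 \<le> (a\<^sup>2 + b\<^sup>2 - x * y) * N * d" "0 \<le> (x * y - d) * p * q"
    using x y p q d N xy by simp_all
  show "2 * x * ((a + b)\<^sup>2 - y\<^sup>2) * d3 a b y + 2 * y * ((a + b)\<^sup>2 - x\<^sup>2) * d3 a b x
      + 4 * (a\<^sup>2 + b\<^sup>2 - x * y) * (2 * a\<^sup>2 + 2 * b\<^sup>2 - x\<^sup>2 - y\<^sup>2) * (a - b)\<^sup>2
      + 2 * (x * y - (a - b)\<^sup>2) * (x\<^sup>2 - (a - b)\<^sup>2) * (y\<^sup>2 - (a - b)\<^sup>2) \<ge> 0"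
    unfolding E d_def[symmetric] N_def[symmetric] p_def[symmetric] q_def[symmetric]
    using x y p q d N xy by (intro add_nonneg_nonneg mult_nonneg_nonneg) simp_all
  have "x\<^sup>2 \<le> x * (m + y)" "y\<^sup>2 \<le> y * (m + x)"
    using x y by (simp_all add: power2_eq_square mult_left_mono)
  then have "p \<le> x * (m + y)" "q \<le> y * (m + x)" using p q by linarith+
  then have "p * ((m - y)\<^sup>2 * q) \<le> x * (m + y) * ((m - y)\<^sup>2 * q)"
    "q * ((m - x)\<^sup>2 * p) \<le> y * (m + x) * ((m - x)\<^sup>2 * p)"
    using p q by (auto intro!: mult_right_mono)
  moreover have "(m - x) * (m - y) \<le> (m - x)\<^sup>2 + (m - y)\<^sup>2"
  proof -
    have "0 \<le> (m - x) * (m - y)" using x y by simp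
    then show ?thesis using sum_squares_bound[of "m - x" "m - y"] by (simp only: mult.assoc)
  qed
  then have "(m - x) * (m - y) * (p * q) \<le> ((m - x)\<^sup>2 + (m - y)\<^sup>2) * (p * q)"
    using p q by (intro mult_right_mono) auto
  ultimately have main: "(m - x) * (m - y) * p * q \<le>
      x * (m + y) * (m - y)\<^sup>2 * q + y * (m + x) * (m - x)\<^sup>2 * p"
    by (simp add: algebra_simps)
  \<comment> \<open>Since \<open>(b\<^sup>2 - a\<^sup>2)\<^sup>2 = d m\<^sup>2\<close> and
    \<open>2 (a\<^sup>2 + b\<^sup>2) - m\<^sup>2 = d\<close>, the volume term completes the
    square.\<close>
  have "4 * (a\<^sup>2 + b\<^sup>2 - x * y) * N * d + 2 * N * (x\<^sup>2 * y\<^sup>2 - (b\<^sup>2 - a\<^sup>2)\<^sup>2) = 2 * (N * (x * y - d)\<^sup>2)"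
    unfolding d_def by Groebner_Basis.algebra
  moreover have "0 \<le> N * (x * y - d)\<^sup>2" using N by simp
  moreover have "2 * d3 a b x * d3 a b y = 2 * ((m - x) * (m - y) * p * q)"
    "2 * (x * y - d) * p * q = 2 * ((x * y - d) * p * q)"
    by (simp_all add: dx dy)
  ultimately show "2 * x * ((a + b)\<^sup>2 - y\<^sup>2) * d3 a b y + 2 * y * ((a + b)\<^sup>2 - x\<^sup>2) * d3 a b x
      + 4 * (a\<^sup>2 + b\<^sup>2 - x * y) * (2 * a\<^sup>2 + 2 * b\<^sup>2 - x\<^sup>2 - y\<^sup>2) * (a - b)\<^sup>2
      + 2 * (x * y - (a - b)\<^sup>2) * (x\<^sup>2 - (a - b)\<^sup>2) * (y\<^sup>2 - (a - b)\<^sup>2)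
      + 2 * (2 * a\<^sup>2 + 2 * b\<^sup>2 - x\<^sup>2 - y\<^sup>2) * (x\<^sup>2 * y\<^sup>2 - (b\<^sup>2 - a\<^sup>2)\<^sup>2)
      \<ge> 2 * d3 a b x * d3 a b y"
    unfolding E d_def[symmetric] N_def[symmetric] p_def[symmetric] q_def[symmetric]
    using E0(4) main by linarith
qed

theorem mainTheorem7:
  fixes X :: "nat \<Rightarrow> real^3"
    and \<alpha> \<beta> :: "nat \<Rightarrow> nat \<Rightarrow> complex"
    and a b x y :: real
  assumes distinct_points: "inj_on X {1..4}"
    and wedge_a: "edge X 1 3 = a" "edge X 2 4 = a"
    and wedge_b: "edge X 2 3 = b" "edge X 1 4 = b"
    and wedge_x: "edge X 1 2 = x"
    and wedge_y: "edge X 3 4 = y"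
    and forms: "admissible_forms X \<alpha> \<beta>"
  shows
    "Re (atiyah_D4 X \<alpha> \<beta>) =
        (d3 a b x + 8 * a * b * x) * (d3 a b y + 8 * a * b * y) + d3 a b x * d3 a b y
        + 2 * x * ((a + b)\<^sup>2 - y\<^sup>2) * d3 a b y + 2 * y * ((a + b)\<^sup>2 - x\<^sup>2) * d3 a b x
        + 4 * (a\<^sup>2 + b\<^sup>2 - x * y) * (2 * a\<^sup>2 + 2 * b\<^sup>2 - x\<^sup>2 - y\<^sup>2) * (a - b)\<^sup>2
        + 2 * (x * y - (a - b)\<^sup>2) * (x\<^sup>2 - (a - b)\<^sup>2) * (y\<^sup>2 - (a - b)\<^sup>2)
        + 288 * (tetra_volume X)\<^sup>2
     \<and> Re (atiyah_D4 X \<alpha> \<beta>) \<ge>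
        (d3 a b x + 8 * a * b * x) * (d3 a b y + 8 * a * b * y) + d3 a b x * d3 a b y
        + 288 * (tetra_volume X)\<^sup>2
     \<and> Re (atiyah_D4 X \<alpha> \<beta>) \<ge>
        (d3 a b x + 8 * a * b * x) * (d3 a b y + 8 * a * b * y) + 3 * d3 a b x * d3 a b y
     \<and> cmod (atiyah_D4 X \<alpha> \<beta>) \<ge> 64 * (\<Prod>(i, j) \<in> pairs4. edge X i j)
     \<and> (cmod (atiyah_D4 X \<alpha> \<beta>))\<^sup>2 \<ge>
        (\<Prod>(i, j, k) \<in> triples4.
          d3 (edge X i j) (edge X i k) (edge X j k) + 8 * edge X i j * edge X i k * edge X j k)"
proof -
  have nonneg: "0 \<le> a" "0 \<le> b" "0 \<le> x" "0 \<le> y"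
    using wedge_a wedge_b wedge_x wedge_y by (auto simp: edge_def)
  \<comment> \<open>Triangle inequalities in the face 123; those for \<open>y\<close> come from the
    face 134.\<close>
  have x: "\<bar>a - b\<bar> \<le> x" "x \<le> a + b"
    using dist_triangle[of "X 1" "X 2" "X 3"] dist_triangle[of "X 1" "X 3" "X 2"]
      dist_triangle[of "X 2" "X 3" "X 1"] wedge_a(1) wedge_b(1) wedge_x
    by (auto simp: edge_def dist_commute)
  have y: "\<bar>a - b\<bar> \<le> y" "y \<le> a + b"
    using dist_triangle[of "X 3" "X 4" "X 1"] dist_triangle[of "X 3" "X 1" "X 4"]
      dist_triangle[of "X 4" "X 1" "X 3"] wedge_a(1) wedge_b(2) wedge_y
    by (auto simp: edge_def dist_commute)
  note D4 = wedge_Re_atiyah_D4[OF distinct_points forms wedge_a wedge_b wedge_x wedge_y]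
  note remainder = wedge_remainder_nonneg[OF x y D4(3)]
  let ?R = "Re (atiyah_D4 X \<alpha> \<beta>)"
  let ?F = "(d3 a b x + 8 * a * b * x) * (d3 a b y + 8 * a * b * y)"
  have lower: "?R \<ge> ?F + d3 a b x * d3 a b y + 288 * (tetra_volume X)\<^sup>2"
    using D4(1) remainder(3) by linarith
  have lower3: "?R \<ge> ?F + 3 * d3 a b x * d3 a b y"
    using D4(1,2) remainder(4) by linarith
  have "0 \<le> d3 a b x * d3 a b y" using remainder(1,2) by simp
  then have "?F \<le> ?R" using lower zero_le_power2[of "tetra_volume X"] by linarith
  then have C: "?F \<le> cmod (atiyah_D4 X \<alpha> \<beta>)" using complex_Re_le_cmod order_trans by blast
  have "64 * (\<Prod>(i, j) \<in> pairs4. edge X i j) = (8 * a * b * x) * (8 * a * b * y)"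
    unfolding pairs4_eq by (simp add: wedge_a wedge_b wedge_x wedge_y del: One_nat_def)
  also have "\<dots> \<le> ?F" using remainder(1,2) nonneg by (intro mult_mono) simp_all
  finally have C2: "64 * (\<Prod>(i, j) \<in> pairs4. edge X i j) \<le> cmod (atiyah_D4 X \<alpha> \<beta>)"
    using C by linarith
  have triples: "triples4 = {(1, 2, 3), (1, 2, 4), (1, 3, 4), (2, 3, 4)}"
    by (auto simp: triples4_def)
  \<comment> \<open>Faces 123 and 124 have sides \<open>a\<close>, \<open>b\<close>,
    \<open>x\<close>, and faces 134 and 234 have sides \<open>a\<close>, \<open>b\<close>,
    \<open>y\<close>; by symmetry of \<open>d3\<close> the product over faces is a perfect
    square.\<close>
  have "(\<Prod>(i, j, k) \<in> triples4.
      d3 (edge X i j) (edge X i k) (edge X j k) + 8 * edge X i j * edge X i k * edge X j k) =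
    (d3 x a b + 8 * x * a * b) * (d3 x b a + 8 * x * b * a)
      * (d3 a b y + 8 * a * b * y) * (d3 b a y + 8 * b * a * y)"
    unfolding triples by (simp add: wedge_a wedge_b wedge_x wedge_y del: One_nat_def)
  also have "\<dots> = ?F\<^sup>2"
    unfolding d3_def by Groebner_Basis.algebra
  also have "\<dots> \<le> (cmod (atiyah_D4 X \<alpha> \<beta>))\<^sup>2"
    using remainder(1,2) nonneg by (intro power_mono[OF C] mult_nonneg_nonneg add_nonneg_nonneg) simp_all
  finally show ?thesis using D4(1) lower lower3 C2 by blast
qed

end
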